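(* Let $n\geqslant2$, let $f\in\ell^2(\mathbb Z^n)$ satisfy $e^{\gamma\left\langle\cdot\right\rangle}f\in\ell^2(\mathbb Z^n)$ for all $\gamma\in\mathbb R_+$, let $u\colon\mathbb Z^n\to\mathbb C$ satisfy \[\frac1R\sum_{\xi\in\mathbb Z^n,\,|\xi|\leqslant R}|u(\xi)|^2\longrightarrow0\quad(R\to\infty),\] let $\lambda\in\left]0,n\right[$, and assume $(-\Delta_{\mathrm{disc}}-\lambda)u=f$ in $\mathbb Z^n$. Then $e^{\gamma\left\langle\cdot\right\rangle}u\in\ell^2(\mathbb Z^n)$ for all $\gamma\in\mathbb R_+$.
   Context: $\left\langle \xi\right\rangle=\sqrt{1+|\xi|^2}$. For $u\colon\mathbb Z^n\to\mathbb C$, $(-\Delta_{\mathrm{disc}}u)(\xi)=\frac n2u(\xi)-\frac14\sum_{\ell=1}^n\bigl(u(\xi+e_\ell)+u(\xi-e_\ell)\bigr)$, where $e_1,\dots,e_n$ is the standard basis of $\mathbb R^n$. *)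

theory Defs
  imports "HOL-Analysis.Analysis"
begin

definition zn_norm :: "int ^ 'n \<Rightarrow> real" where
  "zn_norm \<xi> = sqrt (\<Sum>i\<in>UNIV. (real_of_int (\<xi> $ i))\<^sup>2)"

definition japanese :: "int ^ 'n \<Rightarrow> real" where
  "japanese \<xi> = sqrt (1 + (zn_norm \<xi>)\<^sup>2)"

definition in_l2 :: "(int ^ 'n \<Rightarrow> complex) \<Rightarrow> bool" where
  "in_l2 f \<longleftrightarrow> (\<lambda>\<xi>. (cmod (f \<xi>))\<^sup>2) summable_on UNIV"

definition neg_disc_lap :: "(int ^ 'n \<Rightarrow> complex) \<Rightarrow> int ^ 'n \<Rightarrow> complex" where
  "neg_disc_lap u \<xi> = of_nat CARD('n) / 2 * u \<xi>
     - 1/4 * (\<Sum>l\<in>UNIV. u (\<xi> + axis l 1) + u (\<xi> - axis l 1))"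

end

theory Submission
  imports Defs "HOL-Complex_Analysis.Conformal_Mappings" "HOL-Probability.Infinite_Product_Measure"
    "HOL-Real_Asymp.Real_Asymp"
begin

text \<open>
  Put \<open>E = 2n - 4\<lambda>\<close>, so that the equation reads \<open>(A - E) u = g\<close> with \<open>A\<close> the sum over nearest
  neighbours, \<open>g = - 4 f\<close> and \<open>\<bar>E\<bar> < 2n\<close>. Fix a coordinate \<open>j\<close> and apply the Fourier transform in the
  other coordinates \<open>x\<close>: in direction \<open>j\<close> the operator becomes the three-term recurrence
  \<open>q(m+1) + q(m-1) = t q(m)\<close> with \<open>t = E - 2 (\<Sum>i\<noteq>j. cos x\<^sub>i)\<close>. Kernels built from bounded families \<open>q\<close>
  have square sum \<open>O(R)\<close> on balls by Bessel's inequality, so that Green's formula with a tent cutoff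
  pairs them with \<open>u\<close> without boundary contribution.

  Pairing with the Chebyshev solutions over an open set where \<open>\<bar>t\<bar> < 2\<close> (nonempty since \<open>\<bar>E\<bar> < 2n\<close>) shows
  that two entire functions of \<open>x\<close> attached to \<open>g\<close> vanish there, hence everywhere; these functions
  are single-valued because Chebyshev polynomials replace the two roots of \<open>r + 1/r = t\<close>, so no
  connectedness of the Fermi surface enters. Consequently \<open>g\<close> is annihilated by \<open>r\<^sup>m\<close> for both
  roots and all \<open>x\<close>. Pairing next with \<open>sgn(m) r\<^bsup>\<bar>m\<bar>\<^esup>\<close>, \<open>\<bar>r\<bar> \<le> 1\<close>, whose source is a difference of two unit
  masses, expresses \<open>u(\<eta> + e\<^sub>j) - u(\<eta> - e\<^sub>j)\<close> through a tail of \<open>g\<close>, and summing along the line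
  bounds \<open>u\<close> by \<open>C exp(- a \<bar>\<eta>\<^sub>j\<bar>)\<close> for each \<open>j\<close> and \<open>a\<close>.
\<close>

section \<open>Norms and decay on the lattice\<close>

text \<open>Serves as the working weight because \<open>exp (- l1norm \<xi>)\<close> factors over
  the coordinates; it is equivalent to \<open>zn_norm\<close>, which governs the balls and the final
  weight.\<close>

definition l1norm :: "int ^ 'n \<Rightarrow> real" where
  "l1norm \<xi> = (\<Sum>i\<in>UNIV. \<bar>real_of_int (\<xi> $ i)\<bar>)"

lemma zn_norm_eq_norm: "zn_norm \<xi> = norm (\<chi> i. real_of_int (\<xi> $ i))"
  by (simp add: zn_norm_def norm_vec_def L2_set_def)

lemma zn_norm_nonneg [simp]: "0 \<le> zn_norm \<xi>"
  by (simp add: zn_norm_eq_norm)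

lemma zn_norm_add_le: "zn_norm (\<xi> + \<eta>) \<le> zn_norm \<xi> + zn_norm \<eta>"
proof -
  have "(\<chi> i. real_of_int ((\<xi> + \<eta>) $ i)) = (\<chi> i. real_of_int (\<xi> $ i)) + (\<chi> i. real_of_int (\<eta> $ i))"
    by (simp add: vec_eq_iff)
  then show ?thesis
    unfolding zn_norm_eq_norm by (metis norm_triangle_ineq)
qed

lemma zn_norm_uminus [simp]: "zn_norm (- \<xi>) = zn_norm \<xi>"
  by (simp add: zn_norm_def)

lemma zn_norm_axis [simp]: "zn_norm (axis l 1 :: int ^ 'n) = 1"
proof -
  have "(\<chi> i. real_of_int ((axis l 1 :: int ^ 'n) $ i)) = axis l 1"
    by (simp add: vec_eq_iff axis_def)
  then show ?thesis by (simp add: zn_norm_eq_norm)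
qed

lemma component_le_zn_norm: "\<bar>real_of_int (\<xi> $ i)\<bar> \<le> zn_norm \<xi>"
  using component_le_norm_cart[of "\<chi> i. real_of_int (\<xi> $ i)" i]
  by (simp add: zn_norm_eq_norm)

lemma component_le_l1norm: "\<bar>real_of_int (\<xi> $ i)\<bar> \<le> l1norm \<xi>"
  unfolding l1norm_def by (rule member_le_sum) auto

lemma l1norm_nonneg [simp]: "0 \<le> l1norm \<xi>"
  by (simp add: l1norm_def sum_nonneg)

lemma zn_norm_le_l1norm: "zn_norm \<xi> \<le> l1norm \<xi>"
  unfolding zn_norm_eq_norm l1norm_def
  by (rule order_trans[OF norm_le_l1_cart]) simp

lemma l1norm_le_zn_norm: "l1norm (\<xi> :: int ^ 'n) \<le> real CARD('n) * zn_norm \<xi>"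
  unfolding l1norm_def
  using sum_bounded_above[of UNIV "\<lambda>i. \<bar>real_of_int (\<xi> $ i)\<bar>" "zn_norm \<xi>"] component_le_zn_norm
  by auto

section \<open>Finite balls and summability of exponential weights\<close>

lemma box_eq_image:
  "{\<xi> :: int ^ 'n. \<forall>i. \<xi> $ i \<in> A} = vec_lambda ` (PiE UNIV (\<lambda>_. A))"
proof -
  have "\<xi> \<in> vec_lambda ` (PiE UNIV (\<lambda>_. A))" if "\<forall>i. \<xi> $ i \<in> A" for \<xi> :: "int ^ 'n"
    using that by (intro image_eqI[of _ _ "vec_nth \<xi>"]) auto
  then show ?thesis by auto
qed

lemma finite_box: "finite A \<Longrightarrow> finite {\<xi> :: int ^ 'n. \<forall>i. \<xi> $ i \<in> A}"
  unfolding box_eq_image by (intro finite_imageI finite_PiE) auto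

lemma finite_zn_ball: "finite {\<xi> :: int ^ 'n. zn_norm \<xi> \<le> R}"
proof (rule finite_subset)
  show "{\<xi> :: int ^ 'n. zn_norm \<xi> \<le> R} \<subseteq> {\<xi>. \<forall>i. \<xi> $ i \<in> {-\<lceil>R\<rceil>..\<lceil>R\<rceil>}}"
  proof clarify
    fix \<xi> :: "int ^ 'n" and i assume "zn_norm \<xi> \<le> R"
    then have "\<bar>real_of_int (\<xi> $ i)\<bar> \<le> R"
      using component_le_zn_norm[of \<xi> i] by linarith
    then show "\<xi> $ i \<in> {-\<lceil>R\<rceil>..\<lceil>R\<rceil>}" by (auto simp: abs_le_iff) linarith+
  qed
qed (rule finite_box, simp)

lemma sum_exp_neg_abs_le:
  "(\<Sum>k\<in>{-int K..int K}. exp (- \<bar>real_of_int k\<bar>)) \<le> 2 / (1 - exp (-1))"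
proof -
  have "{-int K..int K} \<subseteq> int ` {..K} \<union> (\<lambda>k. - int k) ` {..K}"
  proof
    fix k assume "k \<in> {-int K..int K}"
    then show "k \<in> int ` {..K} \<union> (\<lambda>k. - int k) ` {..K}"
      by (cases k rule: int_cases2) auto
  qed
  then have "(\<Sum>k\<in>{-int K..int K}. exp (- \<bar>real_of_int k\<bar>)) \<le>
      (\<Sum>k\<in>int ` {..K} \<union> (\<lambda>k. - int k) ` {..K}. exp (- \<bar>real_of_int k\<bar>))"
    by (intro sum_mono2) auto
  also have "\<dots> \<le> (\<Sum>k\<in>int ` {..K}. exp (- \<bar>real_of_int k\<bar>)) +
      (\<Sum>k\<in>(\<lambda>k. - int k) ` {..K}. exp (- \<bar>real_of_int k\<bar>))"
    by (subst sum_Un) (auto intro!: sum_nonneg)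
  also have "\<dots> = 2 * (\<Sum>k\<le>K. exp (-1) ^ k)"
    by (subst sum.reindex, simp add: inj_on_def)+ (simp add: exp_of_nat_mult[symmetric])
  also have "(\<Sum>k\<le>K. exp (-1::real) ^ k) \<le> 1 / (1 - exp (-1))"
  proof -
    have "summable (\<lambda>k. exp (-1::real) ^ k)" by (rule summable_geometric) simp
    then have "(\<Sum>k\<le>K. exp (-1::real) ^ k) \<le> (\<Sum>k. exp (-1) ^ k)"
      by (intro sum_le_suminf) auto
    also have "\<dots> = 1 / (1 - exp (-1))" by (rule suminf_geometric) simp
    finally show ?thesis .
  qed
  finally show ?thesis by simp
qed

text \<open>Every finite set lies in a box, where the sum factors into one geometric sum per
  coordinate, bounded independently of the box.\<close>

lemma summable_exp_l1norm: "(\<lambda>\<xi> :: int ^ 'n. exp (- l1norm \<xi>)) summable_on UNIV"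
proof (rule nonneg_bdd_above_summable_on)
  show "bdd_above (sum (\<lambda>\<xi> :: int ^ 'n. exp (- l1norm \<xi>)) ` {F. F \<subseteq> UNIV \<and> finite F})"
  proof (rule bdd_aboveI2, clarify)
    fix S :: "(int ^ 'n) set" assume S: "finite S"
    define K where "K = nat \<lceil>\<Sum>\<xi>\<in>S. l1norm \<xi>\<rceil>"
    have "S \<subseteq> {\<xi>. \<forall>i. \<xi> $ i \<in> {-int K..int K}}"
    proof clarify
      fix \<xi> i assume "\<xi> \<in> S"
      then have "l1norm \<xi> \<le> (\<Sum>\<xi>\<in>S. l1norm \<xi>)" using S by (intro member_le_sum) auto
      then have "\<bar>real_of_int (\<xi> $ i)\<bar> \<le> real K"
        using component_le_l1norm[of \<xi> i] unfolding K_def by linarith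
      then show "\<xi> $ i \<in> {-int K..int K}" by auto
    qed
    then have "(\<Sum>\<xi>\<in>S. exp (- l1norm \<xi>)) \<le> (\<Sum>\<xi>\<in>{\<xi>::int^'n. \<forall>i. \<xi> $ i \<in> {-int K..int K}}. exp (- l1norm \<xi>))"
      by (intro sum_mono2 finite_box) auto
    also have "\<dots> = (\<Sum>k\<in>PiE (UNIV::'n set) (\<lambda>_. {-int K..int K}). \<Prod>i\<in>UNIV. exp (- \<bar>real_of_int (k i)\<bar>))"
      unfolding box_eq_image
      by (subst sum.reindex) (auto simp: inj_on_def vec_lambda_inject l1norm_def exp_sum sum_negf[symmetric])
    also have "\<dots> = (\<Prod>i\<in>(UNIV::'n set). \<Sum>k\<in>{-int K..int K}. exp (- \<bar>real_of_int k\<bar>))"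
      by (rule prod_sum_PiE[symmetric]) auto
    also have "\<dots> \<le> (\<Prod>i\<in>(UNIV::'n set). 2 / (1 - exp (-1)))"
      by (intro prod_mono conjI sum_exp_neg_abs_le sum_nonneg) auto
    finally show "(\<Sum>\<xi>\<in>S. exp (- l1norm \<xi>)) \<le> (\<Prod>i\<in>(UNIV::'n set). 2 / (1 - exp (-1)))" .
  qed
qed auto

text \<open>The constant may depend on the rate. Since a larger rate is always available, lost
  factors \<open>exp (b * l1norm \<xi>)\<close> can be absorbed, so this pointwise form can stand in
  for the weighted square sums of the theorem.\<close>

definition superexp :: "(int ^ 'n \<Rightarrow> complex) \<Rightarrow> bool" where
  "superexp g \<longleftrightarrow> (\<forall>a. \<exists>C. \<forall>\<xi>. cmod (g \<xi>) \<le> C * exp (- a * l1norm \<xi>))"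

lemma superexp_summable:
  assumes "superexp g"
  shows "(\<lambda>\<xi>. cmod (g \<xi>) * exp (a * l1norm \<xi>)) summable_on UNIV"
proof -
  obtain C where C: "cmod (g \<xi>) \<le> C * exp (- (a + 1) * l1norm \<xi>)" for \<xi>
    using assms unfolding superexp_def by blast
  have "cmod (g \<xi>) * exp (a * l1norm \<xi>) \<le> C * exp (- l1norm \<xi>)" for \<xi>
  proof -
    have "cmod (g \<xi>) * exp (a * l1norm \<xi>) \<le> C * exp (- (a + 1) * l1norm \<xi>) * exp (a * l1norm \<xi>)"
      by (rule mult_right_mono[OF C]) simp
    also have "\<dots> = C * exp (- l1norm \<xi>)"
      by (simp add: mult.assoc exp_add[symmetric] algebra_simps)
    finally show ?thesis .
  qed
  then show ?thesis
    by (intro summable_on_comparison_test[OF summable_on_cmult_right[OF summable_exp_l1norm]]) auto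
qed

lemma summable_on_pointwise_le:
  fixes h :: "'a \<Rightarrow> real"
  assumes "h summable_on UNIV" "\<And>x. 0 \<le> h x"
  shows "h x \<le> infsum h UNIV"
  using finite_sum_le_infsum[of h UNIV "{x}"] assms by auto

section \<open>Passage between weighted square sums and pointwise decay\<close>

lemma zn_norm_le_japanese: "zn_norm \<xi> \<le> japanese \<xi>"
  unfolding japanese_def by (rule real_le_rsqrt) simp

lemma japanese_le: "japanese \<xi> \<le> 1 + zn_norm \<xi>"
  unfolding japanese_def by (rule real_le_lsqrt) (auto simp: power2_sum)

text \<open>A term of a convergent nonnegative series is at most its sum, so a weighted square sum
  already yields a pointwise bound.\<close>

lemma superexp_of_weighted_l2:
  fixes f :: "int ^ 'n \<Rightarrow> complex"
  assumes "\<And>\<gamma>::real. \<gamma> > 0 \<Longrightarrow> in_l2 (\<lambda>\<xi>. exp (\<gamma> * japanese \<xi>) * f \<xi>)"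
  shows "superexp f"
  unfolding superexp_def
proof
  fix a :: real
  \<comment> \<open>The dimension converts \<open>l1norm\<close> into \<open>zn_norm\<close>;
    \<open>max 1 a\<close> keeps the rate positive for every real \<open>a\<close>.\<close>
  define b where "b = real CARD('n) * max 1 a"
  have b: "b > 0" by (simp add: b_def)
  define h where "h = (\<lambda>\<xi>. (cmod (exp (b * japanese \<xi>) * f \<xi>))\<^sup>2)"
  have "h summable_on UNIV" using assms[OF b] unfolding in_l2_def h_def by simp
  then have h: "h \<xi> \<le> infsum h UNIV" for \<xi>
    by (rule summable_on_pointwise_le) (simp add: h_def)
  have "cmod (f \<xi>) \<le> sqrt (infsum h UNIV) * exp (- a * l1norm \<xi>)" for \<xi>
  proof -
    have "exp (b * japanese \<xi>) * cmod (f \<xi>) \<le> sqrt (infsum h UNIV)"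
      by (rule real_le_rsqrt) (use h[of \<xi>] in \<open>simp add: h_def norm_mult\<close>)
    moreover have "a * l1norm \<xi> \<le> b * japanese \<xi>"
    proof -
      have "a * l1norm \<xi> \<le> max 1 a * l1norm \<xi>" by (rule mult_right_mono) auto
      also have "\<dots> \<le> max 1 a * (real CARD('n) * zn_norm \<xi>)"
        by (rule mult_left_mono[OF l1norm_le_zn_norm]) auto
      also have "\<dots> = b * zn_norm \<xi>" by (simp add: b_def)
      also have "\<dots> \<le> b * japanese \<xi>" using b zn_norm_le_japanese by (intro mult_left_mono) auto
      finally show ?thesis .
    qed
    then have "exp (a * l1norm \<xi>) * cmod (f \<xi>) \<le> exp (b * japanese \<xi>) * cmod (f \<xi>)"
      by (intro mult_right_mono) auto
    ultimately have "exp (a * l1norm \<xi>) * cmod (f \<xi>) \<le> sqrt (infsum h UNIV)" by linarith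
    then show ?thesis by (simp add: exp_minus field_simps)
  qed
  then show "\<exists>C. \<forall>\<xi>. cmod (f \<xi>) \<le> C * exp (- a * l1norm \<xi>)" by blast
qed

text \<open>Since \<open>japanese \<xi> \<le> 1 + l1norm \<xi>\<close>, decay at rate
  \<open>\<gamma> + 1\<close> leaves a summable factor \<open>exp (- l1norm \<xi>)\<close>, at the
  cost of a constant \<open>exp \<gamma>\<close>.\<close>

lemma weighted_l2_of_superexp:
  fixes u :: "int ^ 'n \<Rightarrow> complex"
  assumes "superexp u" "\<gamma> > 0"
  shows "in_l2 (\<lambda>\<xi>. exp (\<gamma> * japanese \<xi>) * u \<xi>)"
proof -
  obtain C where C: "cmod (u \<xi>) \<le> C * exp (- (\<gamma> + 1) * l1norm \<xi>)" for \<xi>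
    using assms(1) unfolding superexp_def by blast
  have "0 \<le> C" using order_trans[OF norm_ge_zero C[of 0]] by (simp add: l1norm_def)
  have bd: "(cmod (exp (\<gamma> * japanese \<xi>) * u \<xi>))\<^sup>2 \<le> (C * exp \<gamma>)\<^sup>2 * exp (- l1norm \<xi>)" for \<xi>
  proof -
    have "\<gamma> * japanese \<xi> \<le> \<gamma> * (1 + l1norm \<xi>)"
      using japanese_le[of \<xi>] zn_norm_le_l1norm[of \<xi>] assms(2) by (intro mult_left_mono) auto
    then have "exp (\<gamma> * japanese \<xi>) \<le> exp (\<gamma> * (1 + l1norm \<xi>))" by simp
    then have "cmod (exp (\<gamma> * japanese \<xi>) * u \<xi>) \<le> exp (\<gamma> * (1 + l1norm \<xi>)) * (C * exp (- (\<gamma> + 1) * l1norm \<xi>))"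
      unfolding norm_mult using C[of \<xi>] by (intro mult_mono) auto
    also have "\<dots> = C * exp \<gamma> * exp (- l1norm \<xi>)"
      by (simp add: exp_add[symmetric] algebra_simps)
    finally have "(cmod (exp (\<gamma> * japanese \<xi>) * u \<xi>))\<^sup>2 \<le> (C * exp \<gamma> * exp (- l1norm \<xi>))\<^sup>2"
      by (rule power_mono) simp
    also have "\<dots> = (C * exp \<gamma>)\<^sup>2 * (exp (- l1norm \<xi>))\<^sup>2" by (simp add: power_mult_distrib)
    also have "(exp (- l1norm \<xi>))\<^sup>2 \<le> exp (- l1norm \<xi>)"
      by (simp add: power2_eq_square mult_le_cancel_left1)
    finally show ?thesis by (simp add: mult_left_mono)
  qed
  show ?thesis unfolding in_l2_def
    by (rule summable_on_comparison_test[OF summable_on_cmult_right[OF summable_exp_l1norm]])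
       (use bd in auto)
qed

section \<open>Characters of the torus\<close>

text \<open>Normalised to mass 1, so that characters are orthonormal and integrals are bounded by
  the supremum.\<close>

definition circ :: "real measure" where
  "circ = uniform_measure lborel {0..2 * pi}"

definition torus :: "('n::finite \<Rightarrow> real) measure" where
  "torus = PiM UNIV (\<lambda>_. circ)"

lemma prob_space_circ: "prob_space circ"
  unfolding circ_def by (rule prob_space_uniform_measure) auto

lemma sets_circ [measurable_cong, simp]: "sets circ = sets borel"
  by (simp add: circ_def)

lemma space_circ [simp]: "space circ = UNIV"
  by (simp add: circ_def)

lemma prob_space_torus: "prob_space torus"
  unfolding torus_def by (rule prob_space_PiM) (rule prob_space_circ)

lemma space_torus [simp]: "space torus = UNIV"
  by (simp add: torus_def space_PiM)

lemma measurable_torus_component [measurable]: "(\<lambda>x. x i) \<in> borel_measurable torus"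
  unfolding torus_def by measurable

lemma integral_circ:
  fixes h :: "real \<Rightarrow> complex"
  assumes [measurable]: "h \<in> borel_measurable borel"
  shows "integral\<^sup>L circ h = (\<integral>x. indicator {0..2 * pi} x *\<^sub>R h x \<partial>lborel) / (2 * pi)"
proof -
  have d: "circ = density lborel (\<lambda>x. ennreal (indicator {0..2 * pi} x / (2 * pi)))"
    unfolding circ_def uniform_measure_def
    by (intro arg_cong2[where f = density] refl ext)
       (auto split: split_indicator simp: divide_ennreal[of 1, simplified, symmetric])
  have "integral\<^sup>L circ h = (\<integral>x. (indicator {0..2 * pi} x / (2 * pi)) *\<^sub>R h x \<partial>lborel)"
    unfolding d by (rule integral_density) auto
  also have "\<dots> = (\<integral>x. (indicator {0..2 * pi} x *\<^sub>R h x) / (2 * pi) \<partial>lborel)"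
    by (intro Bochner_Integration.integral_cong) (auto split: split_indicator simp: scaleR_conv_of_real)
  finally show ?thesis by simp
qed

lemma integral_circ_character:
  "(\<integral>x. exp (\<i> * (of_real x * of_int k)) \<partial>circ) = (if k = 0 then 1 else 0)"
proof (cases "k = 0")
  case True
  then show ?thesis using prob_space.prob_space[OF prob_space_circ] by simp
next
  case False
  define F where "F = (\<lambda>x. exp (\<i> * (of_real x * of_int k)) / (\<i> * of_int k))"
  have "(\<integral>x. indicator {0..2 * pi} x *\<^sub>R exp (\<i> * (complex_of_real x * of_int k)) \<partial>lborel) = F (2 * pi) - F 0"
  proof (rule integral_FTC_Icc)
    fix x :: real
    show "(F has_vector_derivative exp (\<i> * (complex_of_real x * of_int k))) (at x within {0..2 * pi})"
    proof -
      have "((\<lambda>z. exp (\<i> * (z * of_int k)) / (\<i> * of_int k)) has_field_derivative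
          exp (\<i> * (complex_of_real x * of_int k))) (at (complex_of_real x))"
        using False by (auto intro!: derivative_eq_intros simp: field_simps)
      then show ?thesis
        unfolding F_def by (rule has_vector_derivative_real_field)
    qed
  qed (auto intro!: continuous_intros)
  also have "F (2 * pi) = F 0"
  proof -
    have "exp (\<i> * (complex_of_real (2 * pi) * of_int k)) = 1"
      by (subst exp_eq_1) (auto intro!: exI[of _ k])
    then show ?thesis by (simp add: F_def)
  qed
  finally show ?thesis
    using False by (subst integral_circ) auto
qed

text \<open>The character depends only on the coordinates other than \<open>j\<close>; the \<open>j\<close>-th torus variable is a dummy.\<close>

definition torus_char :: "'n::finite \<Rightarrow> int ^ 'n \<Rightarrow> ('n \<Rightarrow> complex) \<Rightarrow> complex" where
  "torus_char j \<xi> z = exp (\<i> * (\<Sum>i\<in>-{j}. z i * of_int (\<xi> $ i)))"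

abbreviation real_char :: "'n::finite \<Rightarrow> int ^ 'n \<Rightarrow> ('n \<Rightarrow> real) \<Rightarrow> complex" where
  "real_char j \<xi> x \<equiv> torus_char j \<xi> (\<lambda>i. complex_of_real (x i))"

lemma measurable_real_char [measurable]: "(\<lambda>x. real_char j \<xi> x) \<in> borel_measurable torus"
  unfolding torus_char_def by measurable

lemma torus_char_add: "torus_char j (\<xi> + \<eta>) z = torus_char j \<xi> z * torus_char j \<eta> z"
  by (simp add: torus_char_def exp_add[symmetric] algebra_simps sum.distrib)

lemma norm_real_char [simp]: "cmod (real_char j \<xi> x) = 1"
  by (simp add: torus_char_def norm_exp_eq_Re)

lemma cnj_real_char: "cnj (real_char j \<xi> x) = real_char j (- \<xi>) x"
  by (simp add: torus_char_def exp_cnj sum_negf)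

text \<open>Complex arguments serve the analytic continuation; the exponential growth found here is
  absorbed by the decay of \<open>g\<close>.\<close>

lemma norm_torus_char_le:
  assumes "\<And>i. \<bar>Im (z i)\<bar> \<le> M" 
  shows "cmod (torus_char j \<xi> z) \<le> exp (M * l1norm \<xi>)"
proof -
  \<comment> \<open>Any one coordinate, here \<open>undefined\<close>, shows that \<open>M\<close>
    is nonnegative.\<close>
  have M: "0 \<le> M" using assms[of undefined] by linarith
  have "cmod (torus_char j \<xi> z) = exp (\<Sum>i\<in>-{j}. - (Im (z i) * real_of_int (\<xi> $ i)))"
    by (simp add: torus_char_def norm_exp_eq_Re sum_negf)
  also have "(\<Sum>i\<in>-{j}. - (Im (z i) * real_of_int (\<xi> $ i))) \<le> (\<Sum>i\<in>-{j}. M * \<bar>real_of_int (\<xi> $ i)\<bar>)"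
  proof (rule sum_mono)
    fix i
    have "- (Im (z i) * real_of_int (\<xi> $ i)) \<le> \<bar>Im (z i)\<bar> * \<bar>real_of_int (\<xi> $ i)\<bar>"
      by (metis abs_ge_minus_self abs_mult)
    also have "\<dots> \<le> M * \<bar>real_of_int (\<xi> $ i)\<bar>" by (intro mult_right_mono assms) auto
    finally show "- (Im (z i) * real_of_int (\<xi> $ i)) \<le> M * \<bar>real_of_int (\<xi> $ i)\<bar>" .
  qed
  also have "\<dots> \<le> (\<Sum>i\<in>UNIV. M * \<bar>real_of_int (\<xi> $ i)\<bar>)"
    using M by (intro sum_mono2) auto
  finally show ?thesis by (simp add: l1norm_def sum_distrib_left)
qed

lemma integral_real_char:
  "(\<integral>x. real_char j \<xi> x \<partial>torus) = (if \<forall>i. i \<noteq> j \<longrightarrow> \<xi> $ i = 0 then 1 else 0)"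
proof -
  interpret product_sigma_finite "\<lambda>_::'a. circ"
    by (rule product_sigma_finite.intro) (rule prob_space_imp_sigma_finite[OF prob_space_circ])
  \<comment> \<open>Setting the frequency at \<open>j\<close> to 0 extends the product to all
    coordinates; the \<open>j\<close>-th factor then integrates to 1.\<close>
  define k where "k = (\<lambda>i. if i = j then 0 else \<xi> $ i)"
  have "real_char j \<xi> x = (\<Prod>i\<in>UNIV. exp (\<i> * (complex_of_real (x i) * of_int (k i))))" for x
  proof -
    have "(\<Sum>i\<in>-{j}. complex_of_real (x i) * of_int (\<xi> $ i)) =
          (\<Sum>i\<in>UNIV. complex_of_real (x i) * of_int (k i))"
      by (rule sum.mono_neutral_cong_left) (auto simp: k_def)
    then show ?thesis by (simp add: torus_char_def exp_sum sum_distrib_left)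
  qed
  then have "(\<integral>x. real_char j \<xi> x \<partial>torus) =
      (\<integral>x. (\<Prod>i\<in>UNIV. exp (\<i> * (complex_of_real (x i) * of_int (k i)))) \<partial>PiM UNIV (\<lambda>_. circ))"
    by (simp add: torus_def)
  also have "\<dots> = (\<Prod>i\<in>UNIV. \<integral>x. exp (\<i> * (complex_of_real x * of_int (k i))) \<partial>circ)"
  proof (rule product_integral_prod)
    fix i
    interpret prob_space circ by (rule prob_space_circ)
    show "integrable circ (\<lambda>x. exp (\<i> * (complex_of_real x * of_int (k i))))"
    proof (rule integrable_const_bound[of _ 1])
      show "(\<lambda>x. exp (\<i> * (complex_of_real x * of_int (k i)))) \<in> borel_measurable circ"
        by (simp add: measurable_cong_sets[OF sets_circ refl])
    qed (auto simp: norm_exp_eq_Re)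
  qed simp
  also have "\<dots> = (\<Prod>i\<in>UNIV. if k i = 0 then 1 else 0)"
    by (simp add: integral_circ_character)
  also have "\<dots> = (if \<forall>i. i \<noteq> j \<longrightarrow> \<xi> $ i = 0 then 1 else 0)"
    by (auto simp: k_def prod_zero_iff intro!: prod.neutral)
  finally show ?thesis .
qed

section \<open>Bessel's inequality on a layer\<close>

lemma integrable_torus_bounded:
  fixes h :: "('n::finite \<Rightarrow> real) \<Rightarrow> complex"
  assumes "h \<in> borel_measurable torus" "\<And>x. cmod (h x) \<le> C"
  shows "integrable torus h"
proof -
  interpret prob_space "torus :: ('n \<Rightarrow> real) measure" by (rule prob_space_torus)
  show ?thesis using assms by (intro integrable_const_bound[of _ C]) auto
qed

lemma norm_integral_torus_le:
  fixes h :: "('n::finite \<Rightarrow> real) \<Rightarrow> complex"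
  assumes "\<And>x. cmod (h x) \<le> C"
  shows "cmod (integral\<^sup>L torus h) \<le> C"
proof -
  interpret prob_space "torus :: ('n \<Rightarrow> real) measure" by (rule prob_space_torus)
  have C: "0 \<le> C" using order_trans[OF norm_ge_zero assms] .
  show ?thesis
  proof (cases "integrable torus h")
    case True
    have "cmod (integral\<^sup>L torus h) \<le> (\<integral>x. cmod (h x) \<partial>torus)" by simp
    also have "\<dots> \<le> (\<integral>x. C \<partial>(torus :: ('n \<Rightarrow> real) measure))"
      using True assms by (intro integral_mono) auto
    also have "\<dots> = C" using prob_space by simp
    finally show ?thesis .
  \<comment> \<open>A non-integrable function has integral 0 by convention, which
    \<open>0 \<le> C\<close> covers.\<close>
  qed (simp add: not_integrable_integral_eq C)
qed

text \<open>The character ignores \<open>\<xi> $ j\<close>, so orthonormality is available within a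
  single layer \<open>\<xi> $ j = m\<close>. There \<open>p\<close> is the projection of
  \<open>h\<close> onto finitely many characters, and the nonnegative integral of
  \<open>\<bar>h - p\<bar>\<^sup>2\<close> gives the bound.\<close>

lemma bessel_torus:
  fixes h :: "('n::finite \<Rightarrow> real) \<Rightarrow> complex" and S :: "(int ^ 'n) set"
  assumes [measurable]: "h \<in> borel_measurable torus" and bd: "\<And>x. cmod (h x) \<le> C"
    and S: "finite S" and m: "\<And>\<xi>. \<xi> \<in> S \<Longrightarrow> \<xi> $ j = m"
  shows "(\<Sum>\<xi>\<in>S. (cmod (\<integral>x. real_char j \<xi> x * h x \<partial>torus))\<^sup>2) \<le> C\<^sup>2"
proof -
  define c where "c = (\<lambda>\<xi>. \<integral>x. real_char j \<xi> x * h x \<partial>torus)"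
  \<comment> \<open>\<open>c \<xi>\<close> pairs \<open>h\<close> with the character without
    conjugation, so the projection uses the conjugate characters, those of
    \<open>- \<xi>\<close>.\<close>
  define p where "p = (\<lambda>x. \<Sum>\<xi>\<in>S. c \<xi> * real_char j (- \<xi>) x)"
  define T where "T = (\<Sum>\<xi>\<in>S. (cmod (c \<xi>))\<^sup>2)"
  have [measurable]: "p \<in> borel_measurable torus" unfolding p_def by measurable
  have [measurable]: "cnj \<in> borel_measurable borel"
    by (intro borel_measurable_continuous_onI continuous_intros)
  have pb: "cmod (p x) \<le> (\<Sum>\<xi>\<in>S. cmod (c \<xi>))" for x
    unfolding p_def by (rule order_trans[OF norm_sum]) (simp add: norm_mult)
  have C: "0 \<le> C" using order_trans[OF norm_ge_zero bd] .
  note intg = integrable_torus_bounded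
  have i1: "integrable torus (\<lambda>x. h x * cnj (h x))"
    by (rule intg[of _ "C * C"]) (auto simp: norm_mult intro!: mult_mono bd C)
  have i2: "integrable torus (\<lambda>x. h x * cnj (p x))"
    by (rule intg[of _ "C * (\<Sum>\<xi>\<in>S. cmod (c \<xi>))"]) (auto simp: norm_mult intro!: mult_mono bd pb C)
  have i3: "integrable torus (\<lambda>x. p x * cnj (p x))"
    by (rule intg[of _ "(\<Sum>\<xi>\<in>S. cmod (c \<xi>)) * (\<Sum>\<xi>\<in>S. cmod (c \<xi>))"])
       (auto simp: norm_mult intro!: mult_mono pb sum_nonneg)
  have ih: "integrable torus (\<lambda>x. real_char j \<xi> x * h x)" for \<xi>
    by (rule intg[of _ C]) (auto simp: norm_mult bd)
  have ic: "integrable torus (\<lambda>x. real_char j \<xi> x)" for \<xi>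
    by (rule intg[of _ 1]) auto
  have sq: "complex_of_real (\<integral>x. (cmod (k x))\<^sup>2 \<partial>torus) = (\<integral>x. k x * cnj (k x) \<partial>torus)"
    for k :: "('n \<Rightarrow> real) \<Rightarrow> complex"
    by (subst integral_complex_of_real[symmetric]) (simp only: complex_norm_square)
  have e2: "(\<integral>x. h x * cnj (p x) \<partial>torus) = of_real T"
  proof -
    have "(\<integral>x. h x * cnj (p x) \<partial>torus) = (\<integral>x. (\<Sum>\<xi>\<in>S. cnj (c \<xi>) * (real_char j \<xi> x * h x)) \<partial>torus)"
      by (intro Bochner_Integration.integral_cong refl)
         (simp add: p_def cnj_real_char sum_distrib_left mult_ac)
    also have "\<dots> = (\<Sum>\<xi>\<in>S. cnj (c \<xi>) * c \<xi>)"
      unfolding c_def by (subst Bochner_Integration.integral_sum) (auto simp: ih)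
    also have "\<dots> = of_real T"
      by (simp add: T_def complex_norm_square mult.commute del: of_real_power)
    finally show ?thesis .
  qed
  have e3: "(\<integral>x. p x * cnj (p x) \<partial>torus) = of_real T"
  proof -
    have "(\<integral>x. p x * cnj (p x) \<partial>torus) =
        (\<integral>x. (\<Sum>\<xi>\<in>S. \<Sum>\<eta>\<in>S. (c \<xi> * cnj (c \<eta>)) * real_char j (\<eta> - \<xi>) x) \<partial>torus)"
      by (intro Bochner_Integration.integral_cong refl)
         (simp add: p_def cnj_real_char sum_product mult_ac torus_char_add[of _ _ "- _", simplified])
    also have "\<dots> = (\<Sum>\<xi>\<in>S. \<Sum>\<eta>\<in>S. (c \<xi> * cnj (c \<eta>)) * (\<integral>x. real_char j (\<eta> - \<xi>) x \<partial>torus))"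
      by (simp add: Bochner_Integration.integral_sum ic)
    also have "\<dots> = (\<Sum>\<xi>\<in>S. \<Sum>\<eta>\<in>S. if \<eta> = \<xi> then c \<xi> * cnj (c \<eta>) else 0)"
    proof (intro sum.cong refl)
      fix \<xi> \<eta> assume "\<xi> \<in> S" "\<eta> \<in> S"
      then have "\<xi> $ j = \<eta> $ j" by (simp add: m)
      then have "(\<forall>i. i \<noteq> j \<longrightarrow> (\<eta> - \<xi>) $ i = 0) \<longleftrightarrow> \<eta> = \<xi>"
        by (simp add: vec_eq_iff) metis
      then show "(c \<xi> * cnj (c \<eta>)) * (\<integral>x. real_char j (\<eta> - \<xi>) x \<partial>torus) = (if \<eta> = \<xi> then c \<xi> * cnj (c \<eta>) else 0)"
        by (simp add: integral_real_char)
    qed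
    also have "\<dots> = of_real T"
      using S by (simp add: T_def complex_norm_square del: of_real_power)
    finally show ?thesis .
  qed
  have e4: "(\<integral>x. p x * cnj (h x) \<partial>torus) = of_real T"
  proof -
    have "(\<integral>x. p x * cnj (h x) \<partial>torus) = (\<integral>x. cnj (h x * cnj (p x)) \<partial>torus)"
      by (simp add: mult.commute)
    also have "\<dots> = of_real T" by (simp only: Bochner_Integration.integral_cnj e2 complex_cnj_complex_of_real)
    finally show ?thesis .
  qed
  have i4: "integrable torus (\<lambda>x. p x * cnj (h x))"
    by (rule intg[of _ "(\<Sum>\<xi>\<in>S. cmod (c \<xi>)) * C"])
       (auto simp: norm_mult intro!: mult_mono bd pb sum_nonneg)
  have "of_real (\<integral>x. (cmod (h x - p x))\<^sup>2 \<partial>torus) = (\<integral>x. (h x - p x) * cnj (h x - p x) \<partial>torus)"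
    by (rule sq)
  also have "\<dots> = (\<integral>x. h x * cnj (h x) - h x * cnj (p x) - (p x * cnj (h x) - p x * cnj (p x)) \<partial>torus)"
    by (simp add: algebra_simps)
  also have "\<dots> = (\<integral>x. h x * cnj (h x) \<partial>torus) - of_real T"
    by (simp add: i1 i2 i3 i4 e2 e3 e4)
  also have "(\<integral>x. h x * cnj (h x) \<partial>torus) = of_real (\<integral>x. (cmod (h x))\<^sup>2 \<partial>torus)"
    by (rule sq[symmetric])
  finally have "(\<integral>x. (cmod (h x - p x))\<^sup>2 \<partial>torus) = (\<integral>x. (cmod (h x))\<^sup>2 \<partial>torus) - T"
    by (simp flip: of_real_diff)
  moreover have "0 \<le> (\<integral>x. (cmod (h x - p x))\<^sup>2 \<partial>torus)" by simp
  moreover have "(\<integral>x. (cmod (h x))\<^sup>2 \<partial>torus) \<le> C\<^sup>2"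
  proof -
    have "complex_of_real (\<integral>x. (cmod (h x))\<^sup>2 \<partial>torus) = (\<integral>x. h x * cnj (h x) \<partial>torus)"
      by (rule sq)
    moreover have "cmod (\<integral>x. h x * cnj (h x) \<partial>torus) \<le> C * C"
      by (rule norm_integral_torus_le) (auto simp: norm_mult intro!: mult_mono bd C)
    ultimately have "\<bar>\<integral>x. (cmod (h x))\<^sup>2 \<partial>torus\<bar> \<le> C * C" by (metis norm_of_real)
    then show ?thesis by (simp add: power2_eq_square)
  qed
  ultimately show ?thesis unfolding T_def c_def by linarith
qed

section \<open>Green's formula\<close>

definition zball :: "real \<Rightarrow> (int ^ 'n) set" where
  "zball R = {\<xi>. zn_norm \<xi> \<le> R}"

lemma finite_zball [simp]: "finite (zball R)"
  unfolding zball_def by (rule finite_zn_ball)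

definition nbsum :: "(int ^ 'n \<Rightarrow> complex) \<Rightarrow> int ^ 'n \<Rightarrow> complex" where
  "nbsum u \<xi> = (\<Sum>l\<in>UNIV. u (\<xi> + axis l 1) + u (\<xi> - axis l 1))"

text \<open>A cutoff of slope \<open>1 / R\<close>: its commutator with the neighbour sum has size
  \<open>1 / R\<close> over the whole ball, which matches the averages assumed small for
  \<open>u\<close>. A sharp cutoff would produce sums over spheres instead.\<close>

definition tent :: "real \<Rightarrow> int ^ 'n \<Rightarrow> real" where
  "tent R \<xi> = max 0 (1 - zn_norm \<xi> / R)"

lemma tent_nonneg [simp]: "0 \<le> tent R \<xi>"
  by (simp add: tent_def)

lemma tent_outside: "R > 0 \<Longrightarrow> \<xi> \<notin> zball R \<Longrightarrow> tent R \<xi> = 0"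
  by (simp add: tent_def zball_def)

lemma one_minus_tent: "R > 0 \<Longrightarrow> \<bar>1 - tent R \<xi>\<bar> \<le> zn_norm \<xi> / R"
  by (auto simp: tent_def max_def field_simps)

lemma tent_Lipschitz:
  assumes "R > 0" "zn_norm e = 1"
  shows "\<bar>tent R \<xi> - tent R (\<xi> + e)\<bar> \<le> 1 / R"
proof -
  have "zn_norm (\<xi> + e) \<le> zn_norm \<xi> + 1" "zn_norm \<xi> \<le> zn_norm (\<xi> + e) + 1"
    using zn_norm_add_le[of \<xi> e] zn_norm_add_le[of "\<xi> + e" "- e"] assms by auto
  then have "\<bar>zn_norm (\<xi> + e) / R - zn_norm \<xi> / R\<bar> \<le> 1 / R"
    using assms by (simp add: diff_divide_distrib[symmetric] abs_le_iff field_simps)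
  then show ?thesis unfolding tent_def by linarith
qed

text \<open>Translating the second sum by \<open>e\<close> turns both summands into multiples of
  \<open>w \<xi> * u (\<xi> + e)\<close>. Only a difference of cutoffs remains, and Cauchy-Schwarz
  separates \<open>w\<close> from \<open>u\<close>.\<close>

lemma shift_commutator_bound:
  fixes u w :: "int ^ 'n \<Rightarrow> complex"
  assumes R: "R > 0" and e: "zn_norm e = 1"
  shows "cmod ((\<Sum>\<xi>\<in>zball R. of_real (tent R \<xi>) * (w \<xi> * u (\<xi> + e)))
             - (\<Sum>\<xi>\<in>zball R. of_real (tent R \<xi>) * (u \<xi> * w (\<xi> - e))))
    \<le> 1 / R * (sqrt (\<Sum>\<xi>\<in>zball (R + 1). (cmod (w \<xi>))\<^sup>2) * sqrt (\<Sum>\<xi>\<in>zball (R + 2). (cmod (u \<xi>))\<^sup>2))"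
proof -
  have tr: "zn_norm (\<xi> + e) \<le> zn_norm \<xi> + 1" "zn_norm (\<xi> - e) \<le> zn_norm \<xi> + 1" for \<xi>
    using zn_norm_add_le[of \<xi> e] zn_norm_add_le[of \<xi> "- e"] e by auto
  have 1: "(\<Sum>\<xi>\<in>zball R. of_real (tent R \<xi>) * (w \<xi> * u (\<xi> + e))) =
      (\<Sum>\<xi>\<in>zball (R + 1). of_real (tent R \<xi>) * (w \<xi> * u (\<xi> + e)))"
    by (rule sum.mono_neutral_left) (use R in \<open>auto simp: tent_outside\<close>, auto simp: zball_def)
  \<comment> \<open>The translated ball lies within radius \<open>R + 1\<close>, and then
    \<open>\<xi> + e\<close> stays within radius \<open>R + 2\<close>; hence the two radii in the
    bound.\<close>
  have 2: "(\<Sum>\<xi>\<in>zball R. of_real (tent R \<xi>) * (u \<xi> * w (\<xi> - e))) =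
      (\<Sum>\<xi>\<in>zball (R + 1). of_real (tent R (\<xi> + e)) * (w \<xi> * u (\<xi> + e)))"
  proof -
    have "(\<Sum>\<xi>\<in>zball R. of_real (tent R \<xi>) * (u \<xi> * w (\<xi> - e))) =
        (\<Sum>\<xi>\<in>(\<lambda>\<xi>. \<xi> - e) ` zball R. of_real (tent R (\<xi> + e)) * (w \<xi> * u (\<xi> + e)))"
      by (subst sum.reindex) (auto simp: inj_on_def mult_ac)
    also have "\<dots> = (\<Sum>\<xi>\<in>zball (R + 1). of_real (tent R (\<xi> + e)) * (w \<xi> * u (\<xi> + e)))"
    proof (rule sum.mono_neutral_left)
      show "(\<lambda>\<xi>. \<xi> - e) ` zball R \<subseteq> zball (R + 1)"
      proof clarify
        fix \<xi> :: "int ^ 'n" assume "\<xi> \<in> zball R"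
        then show "\<xi> - e \<in> zball (R + 1)" using tr(2)[of \<xi>] by (simp add: zball_def)
      qed
      show "\<forall>\<xi>\<in>zball (R + 1) - (\<lambda>\<xi>. \<xi> - e) ` zball R. of_real (tent R (\<xi> + e)) * (w \<xi> * u (\<xi> + e)) = 0"
      proof
        fix \<xi> assume "\<xi> \<in> zball (R + 1) - (\<lambda>\<xi>. \<xi> - e) ` zball R"
        then have "\<xi> + e \<notin> zball R" by (metis DiffD2 add_diff_cancel image_eqI)
        then show "of_real (tent R (\<xi> + e)) * (w \<xi> * u (\<xi> + e)) = 0"
          by (simp add: tent_outside[OF R])
      qed
    qed simp
    finally show ?thesis .
  qed
  have "cmod ((\<Sum>\<xi>\<in>zball R. of_real (tent R \<xi>) * (w \<xi> * u (\<xi> + e)))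
             - (\<Sum>\<xi>\<in>zball R. of_real (tent R \<xi>) * (u \<xi> * w (\<xi> - e)))) =
       cmod (\<Sum>\<xi>\<in>zball (R + 1). of_real (tent R \<xi> - tent R (\<xi> + e)) * (w \<xi> * u (\<xi> + e)))"
    unfolding 1 2 by (simp add: sum_subtractf[symmetric] left_diff_distrib)
  also have "\<dots> \<le> (\<Sum>\<xi>\<in>zball (R + 1). 1 / R * (cmod (w \<xi>) * cmod (u (\<xi> + e))))"
  proof (rule sum_norm_le)
    fix \<xi>
    show "cmod (of_real (tent R \<xi> - tent R (\<xi> + e)) * (w \<xi> * u (\<xi> + e))) \<le> 1 / R * (cmod (w \<xi>) * cmod (u (\<xi> + e)))"
      unfolding norm_mult norm_of_real by (rule mult_right_mono[OF tent_Lipschitz[OF R e]]) simp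
  qed
  also have "\<dots> = 1 / R * (\<Sum>\<xi>\<in>zball (R + 1). cmod (w \<xi>) * cmod (u (\<xi> + e)))"
    by (simp add: sum_distrib_left)
  also have "(\<Sum>\<xi>\<in>zball (R + 1). cmod (w \<xi>) * cmod (u (\<xi> + e))) \<le>
      sqrt (\<Sum>\<xi>\<in>zball (R + 1). (cmod (w \<xi>))\<^sup>2) * sqrt (\<Sum>\<xi>\<in>zball (R + 1). (cmod (u (\<xi> + e)))\<^sup>2)"
    unfolding real_sqrt_mult[symmetric]
    by (rule real_le_rsqrt) (rule Cauchy_Schwarz_ineq_sum)
  also have "(\<Sum>\<xi>\<in>zball (R + 1). (cmod (u (\<xi> + e)))\<^sup>2) = (\<Sum>\<xi>\<in>(\<lambda>\<xi>. \<xi> + e) ` zball (R + 1). (cmod (u \<xi>))\<^sup>2)"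
    by (subst sum.reindex) (auto simp: inj_on_def)
  also have "\<dots> \<le> (\<Sum>\<xi>\<in>zball (R + 2). (cmod (u \<xi>))\<^sup>2)"
  proof (rule sum_mono2)
    show "(\<lambda>\<xi>. \<xi> + e) ` zball (R + 1) \<subseteq> zball (R + 2)"
    proof clarify
      fix \<xi> :: "int ^ 'n" assume "\<xi> \<in> zball (R + 1)"
      then show "\<xi> + e \<in> zball (R + 2)" using tr(1)[of \<xi>] by (simp add: zball_def)
    qed
  qed auto
  finally show ?thesis
    using R by (simp add: mult_left_mono divide_right_mono sum_nonneg)
qed

lemma nbsum_commutator_bound:
  fixes u w :: "int ^ 'n \<Rightarrow> complex"
  assumes R: "R > 0"
  shows "cmod (\<Sum>\<xi>\<in>zball R. of_real (tent R \<xi>) * (w \<xi> * nbsum u \<xi> - u \<xi> * nbsum w \<xi>))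
    \<le> 2 * real CARD('n) / R * (sqrt (\<Sum>\<xi>\<in>zball (R + 1). (cmod (w \<xi>))\<^sup>2) * sqrt (\<Sum>\<xi>\<in>zball (R + 2). (cmod (u \<xi>))\<^sup>2))"
proof -
  define D where "D = 1 / R * (sqrt (\<Sum>\<xi>\<in>zball (R + 1). (cmod (w \<xi>))\<^sup>2) * sqrt (\<Sum>\<xi>\<in>zball (R + 2). (cmod (u \<xi>))\<^sup>2))"
  define T where "T = (\<lambda>e. (\<Sum>\<xi>\<in>zball R. of_real (tent R \<xi>) * (w \<xi> * u (\<xi> + e)))
             - (\<Sum>\<xi>\<in>zball R. of_real (tent R \<xi>) * (u \<xi> * w (\<xi> - e))))"
  have T: "cmod (T e) \<le> D" if "zn_norm e = 1" for e
    unfolding T_def D_def by (rule shift_commutator_bound[OF R that])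
  \<comment> \<open>Regrouped so that a shift of \<open>u\<close> by \<open>e\<close> meets the
    shift of \<open>w\<close> by \<open>- e\<close>, once for \<open>e = axis l 1\<close> and once
    for \<open>e = - axis l 1\<close>.\<close>
  have "(\<Sum>\<xi>\<in>zball R. of_real (tent R \<xi>) * (w \<xi> * nbsum u \<xi> - u \<xi> * nbsum w \<xi>)) =
      (\<Sum>\<xi>\<in>zball R. \<Sum>l\<in>UNIV. (of_real (tent R \<xi>) * (w \<xi> * u (\<xi> + axis l 1)) - of_real (tent R \<xi>) * (u \<xi> * w (\<xi> - axis l 1)))
         + (of_real (tent R \<xi>) * (w \<xi> * u (\<xi> + - axis l 1)) - of_real (tent R \<xi>) * (u \<xi> * w (\<xi> - - axis l 1))))"
    by (intro sum.cong refl)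
       (simp add: nbsum_def sum_distrib_left sum_subtractf[symmetric] algebra_simps)
  also have "\<dots> = (\<Sum>l\<in>UNIV. T (axis l 1) + T (- axis l 1))"
    unfolding T_def by (subst sum.swap) (simp add: sum.distrib sum_subtractf)
  also have "cmod \<dots> \<le> (\<Sum>l\<in>(UNIV::'n set). D + D)"
    by (rule sum_norm_le) (intro norm_triangle_le add_mono T, auto)
  also have "\<dots> = 2 * real CARD('n) / R * (sqrt (\<Sum>\<xi>\<in>zball (R + 1). (cmod (w \<xi>))\<^sup>2) * sqrt (\<Sum>\<xi>\<in>zball (R + 2). (cmod (u \<xi>))\<^sup>2))"
    by (simp add: D_def)
  finally show ?thesis .
qed

section \<open>Green's formula in the limit of large radius\<close>

definition small_average :: "(int ^ 'n \<Rightarrow> complex) \<Rightarrow> bool" where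
  "small_average u \<longleftrightarrow> ((\<lambda>R::real. (1 / R) * (\<Sum>\<xi>\<in>zball R. (cmod (u \<xi>))\<^sup>2)) \<longlongrightarrow> 0) at_top"

text \<open>The square sums of \<open>w\<close> grow at most linearly and those of \<open>u\<close>
  are \<open>o(R)\<close>, so the product of their roots is \<open>o(R)\<close> and loses to the
  factor \<open>1 / R\<close>.\<close>

lemma nbsum_commutator_limit:
  fixes u w :: "int ^ 'n \<Rightarrow> complex"
  assumes u: "small_average u"
    and w: "\<And>R. R \<ge> 0 \<Longrightarrow> (\<Sum>\<xi>\<in>zball R. (cmod (w \<xi>))\<^sup>2) \<le> c * (R + 1)"
  shows "((\<lambda>R. \<Sum>\<xi>\<in>zball R. of_real (tent R \<xi>) * (w \<xi> * nbsum u \<xi> - u \<xi> * nbsum w \<xi>)) \<longlongrightarrow> 0) at_top"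
proof -
  define S where "S = (\<lambda>R. \<Sum>\<xi>\<in>zball R. (cmod (u \<xi>))\<^sup>2)"
  have S0: "0 \<le> S R" for R by (simp add: S_def sum_nonneg)
  have c: "0 \<le> c" using order_trans[OF _ w[of 0]] by (simp add: sum_nonneg)
  \<comment> \<open>The square sum of \<open>u\<close> is divided by the radius \<open>R + 2\<close>
    of its own ball, so that the hypothesis applies; the quotient \<open>(R + 2) / R\<close>
    restores the prefactor.\<close>
  have lim: "((\<lambda>R. 2 * real CARD('n) * (((R + 2) / R) * sqrt (c * (1 / (R + 2) * S (R + 2))))) \<longlongrightarrow> 0) at_top"
  proof -
    have "filterlim (\<lambda>R::real. R + 2) at_top at_top"
      by (subst add.commute) (rule filterlim_tendsto_add_at_top[OF tendsto_const filterlim_ident])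
    then have "((\<lambda>R. 1 / (R + 2) * S (R + 2)) \<longlongrightarrow> 0) at_top"
      using u unfolding small_average_def S_def by (rule filterlim_compose[rotated])
    moreover have "((\<lambda>R::real. (R + 2) / R) \<longlongrightarrow> 1) at_top" by real_asymp
    ultimately have "((\<lambda>R. 2 * real CARD('n) * (((R + 2) / R) * sqrt (c * (1 / (R + 2) * S (R + 2)))))
        \<longlongrightarrow> 2 * real CARD('n) * (1 * sqrt (c * 0))) at_top"
      by (intro tendsto_intros)
    then show ?thesis by simp
  qed
  show ?thesis
  proof (rule Lim_null_comparison[OF _ lim], rule eventually_mono[OF eventually_gt_at_top[of 0]])
    fix R :: real assume R: "0 < R"
    have "sqrt (\<Sum>\<xi>\<in>zball (R + 1). (cmod (w \<xi>))\<^sup>2) * sqrt (S (R + 2)) \<le> sqrt (c * (R + 2)) * sqrt (S (R + 2))"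
      using w[of "R + 1"] R S0 by (intro mult_right_mono real_sqrt_le_mono) (auto simp: add.assoc)
    also have "\<dots> = sqrt ((R + 2)\<^sup>2 * (c * (1 / (R + 2) * S (R + 2))))"
      using R by (simp add: real_sqrt_mult[symmetric] power2_eq_square)
    also have "\<dots> = (R + 2) * sqrt (c * (1 / (R + 2) * S (R + 2)))"
      using R by (subst real_sqrt_mult) simp
    finally have "2 * real CARD('n) / R * (sqrt (\<Sum>\<xi>\<in>zball (R + 1). (cmod (w \<xi>))\<^sup>2) * sqrt (S (R + 2)))
        \<le> 2 * real CARD('n) / R * ((R + 2) * sqrt (c * (1 / (R + 2) * S (R + 2))))"
      using R by (intro mult_left_mono) auto
    then show "cmod (\<Sum>\<xi>\<in>zball R. of_real (tent R \<xi>) * (w \<xi> * nbsum u \<xi> - u \<xi> * nbsum w \<xi>))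
        \<le> 2 * real CARD('n) * (((R + 2) / R) * sqrt (c * (1 / (R + 2) * S (R + 2))))"
      using order_trans[OF nbsum_commutator_bound[OF R, of w u]] by (simp add: S_def)
  qed
qed

text \<open>The cutoff differs from 1 by at most \<open>zn_norm \<xi> / R\<close>, and the weight
  dominates \<open>zn_norm \<xi>\<close>, so the error is \<open>O(1 / R)\<close>. The exponent is
  written \<open>1 * l1norm \<xi>\<close> to match \<open>superexp_summable\<close> at rate
  1.\<close>

lemma tent_sum_limit:
  fixes a :: "int ^ 'n \<Rightarrow> complex"
  assumes s: "(\<lambda>\<xi>. cmod (a \<xi>) * exp (1 * l1norm \<xi>)) summable_on UNIV"
  shows "((\<lambda>R. \<Sum>\<xi>\<in>zball R. of_real (tent R \<xi>) * a \<xi>) \<longlongrightarrow> infsum a UNIV) at_top"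
proof -
  define M where "M = (\<Sum>\<^sub>\<infinity>\<xi>. cmod (a \<xi>) * exp (1 * l1norm \<xi>))"
  have zn: "zn_norm \<xi> \<le> exp (1 * l1norm \<xi>)" for \<xi> :: "int ^ 'n"
    using zn_norm_le_l1norm[of \<xi>] exp_ge_add_one_self[of "l1norm \<xi>"]
    by (simp only: mult_1)
  have ge1: "1 \<le> exp (1 * l1norm \<xi>)" for \<xi> :: "int ^ 'n" by simp
  have sa: "a summable_on UNIV"
    by (rule abs_summable_summable[OF summable_on_comparison_test[OF s]])
       (use ge1 in \<open>auto simp: mult_le_cancel_left1\<close>)
  have bound: "cmod ((\<Sum>\<xi>\<in>zball R. of_real (tent R \<xi>) * a \<xi>) - infsum a UNIV) \<le> M * (1 / R)" if R: "R > 0" for R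
  proof -
    have eq: "(\<Sum>\<xi>\<in>zball R. of_real (tent R \<xi>) * a \<xi>) = (\<Sum>\<^sub>\<infinity>\<xi>. of_real (tent R \<xi>) * a \<xi>)"
      by (subst infsum_finite[symmetric], simp, rule infsum_cong_neutral) (auto simp: tent_outside[OF R])
    have sc: "(\<lambda>\<xi>. of_real (tent R \<xi>) * a \<xi>) summable_on UNIV"
      by (rule finite_nonzero_values_imp_summable_on, rule finite_subset[OF _ finite_zball[of R]])
         (use tent_outside[OF R] in auto)
    have le: "cmod (of_real (tent R \<xi>) * a \<xi> - a \<xi>) \<le> (1 / R) * (cmod (a \<xi>) * exp (1 * l1norm \<xi>))" for \<xi>
    proof -
      have "cmod (of_real (tent R \<xi>) * a \<xi> - a \<xi>) = cmod (of_real (tent R \<xi> - 1) * a \<xi>)"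
        by (simp add: algebra_simps)
      also have "\<dots> = \<bar>1 - tent R \<xi>\<bar> * cmod (a \<xi>)"
        by (simp add: norm_mult abs_minus_commute del: of_real_diff)
      also have "\<dots> \<le> (exp (1 * l1norm \<xi>) / R) * cmod (a \<xi>)"
        by (intro mult_right_mono order_trans[OF one_minus_tent[OF R]] divide_right_mono zn) (use R in auto)
      finally show ?thesis by (simp add: mult_ac)
    qed
    have "(\<Sum>\<xi>\<in>zball R. of_real (tent R \<xi>) * a \<xi>) - infsum a UNIV = (\<Sum>\<^sub>\<infinity>\<xi>. of_real (tent R \<xi>) * a \<xi> - a \<xi>)"
      unfolding eq using infsum_add[OF sc iffD2[OF summable_on_uminus sa]]
      by (simp add: infsum_uminus)
    also have "cmod \<dots> \<le> (\<Sum>\<^sub>\<infinity>\<xi>. (1 / R) * (cmod (a \<xi>) * exp (1 * l1norm \<xi>)))"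
    proof (rule norm_infsum_le)
      show "((\<lambda>\<xi>. of_real (tent R \<xi>) * a \<xi> - a \<xi>) has_sum (\<Sum>\<^sub>\<infinity>\<xi>. of_real (tent R \<xi>) * a \<xi> - a \<xi>)) UNIV"
        using summable_on_add[OF sc iffD2[OF summable_on_uminus sa]] by (intro has_sum_infsum) simp
      show "((\<lambda>\<xi>. (1 / R) * (cmod (a \<xi>) * exp (1 * l1norm \<xi>))) has_sum (\<Sum>\<^sub>\<infinity>\<xi>. (1 / R) * (cmod (a \<xi>) * exp (1 * l1norm \<xi>)))) UNIV"
        by (intro has_sum_infsum summable_on_cmult_right s)
    qed (rule le)
    also have "\<dots> = M * (1 / R)" by (subst infsum_cmult_right') (simp add: M_def)
    finally show ?thesis .
  qed
  have "((\<lambda>R. M * (1 / R)) \<longlongrightarrow> M * 0) at_top"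
    by (rule tendsto_mult[OF tendsto_const])
       (simp only: divide_inverse mult_1 tendsto_inverse_0_at_top[OF filterlim_ident])
  then have lim0: "((\<lambda>R. M * (1 / R)) \<longlongrightarrow> 0) at_top" by simp
  have "((\<lambda>R. (\<Sum>\<xi>\<in>zball R. of_real (tent R \<xi>) * a \<xi>) - infsum a UNIV) \<longlongrightarrow> 0) at_top"
    by (rule Lim_null_comparison[OF eventually_mono[OF eventually_gt_at_top[of 0]] lim0]) (rule bound)
  then show ?thesis by (simp add: LIM_zero_iff)
qed

text \<open>In \<open>w * nbsum u - u * nbsum w\<close> the terms with \<open>E\<close> cancel,
  leaving \<open>g * w - r\<close>. Its tent sum tends to 0 while the tent sums of
  \<open>g * w\<close> and of \<open>r\<close> converge separately, so their totals agree.\<close>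

lemma green_pairing:
  fixes u w g :: "int ^ 'n \<Rightarrow> complex" and E :: complex
  assumes u: "small_average u"
    and g: "superexp g" "\<And>\<xi>. nbsum u \<xi> - E * u \<xi> = g \<xi>"
    and w: "\<And>R. R \<ge> 0 \<Longrightarrow> (\<Sum>\<xi>\<in>zball R. (cmod (w \<xi>))\<^sup>2) \<le> c * (R + 1)"
    and wC: "\<And>\<xi>. cmod (w \<xi>) \<le> C"
    and F: "finite F" "\<And>\<xi>. \<xi> \<notin> F \<Longrightarrow> nbsum w \<xi> - E * w \<xi> = 0"
  shows "(\<Sum>\<^sub>\<infinity>\<xi>. g \<xi> * w \<xi>) = (\<Sum>\<xi>\<in>F. u \<xi> * (nbsum w \<xi> - E * w \<xi>))"
proof -
  define r where "r = (\<lambda>\<xi>. u \<xi> * (nbsum w \<xi> - E * w \<xi>))"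
  have C: "0 \<le> C" using order_trans[OF norm_ge_zero wC] .
  have l1: "((\<lambda>R. \<Sum>\<xi>\<in>zball R. of_real (tent R \<xi>) * (g \<xi> * w \<xi>)) \<longlongrightarrow> (\<Sum>\<^sub>\<infinity>\<xi>. g \<xi> * w \<xi>)) at_top"
  proof (rule tent_sum_limit, rule summable_on_comparison_test)
    show "(\<lambda>\<xi>. C * (cmod (g \<xi>) * exp (1 * l1norm \<xi>))) summable_on UNIV"
      by (intro summable_on_cmult_right superexp_summable g)
    show "cmod (g \<xi> * w \<xi>) * exp (1 * l1norm \<xi>) \<le> C * (cmod (g \<xi>) * exp (1 * l1norm \<xi>))" for \<xi>
      using mult_right_mono[OF wC[of \<xi>], of "cmod (g \<xi>) * exp (1 * l1norm \<xi>)"]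
      by (simp add: norm_mult mult_ac)
  qed auto
  have rs: "(\<lambda>\<xi>. cmod (r \<xi>) * exp (1 * l1norm \<xi>)) summable_on UNIV"
    by (rule finite_nonzero_values_imp_summable_on, rule finite_subset[OF _ F(1)])
       (use F(2) in \<open>auto simp: r_def\<close>)
  have l2: "((\<lambda>R. \<Sum>\<xi>\<in>zball R. of_real (tent R \<xi>) * r \<xi>) \<longlongrightarrow> infsum r UNIV) at_top"
    by (rule tent_sum_limit[OF rs])
  have "infsum r UNIV = sum r F"
    by (subst infsum_finite[symmetric, OF F(1)], rule infsum_cong_neutral) (auto simp: r_def F(2))
  moreover have "infsum r UNIV - (\<Sum>\<^sub>\<infinity>\<xi>. g \<xi> * w \<xi>) = 0"
  proof (rule tendsto_unique[OF _ tendsto_diff[OF l2 l1]])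
    have "((\<lambda>R. - (\<Sum>\<xi>\<in>zball R. of_real (tent R \<xi>) * (w \<xi> * nbsum u \<xi> - u \<xi> * nbsum w \<xi>))) \<longlongrightarrow> - 0) at_top"
      by (intro tendsto_minus nbsum_commutator_limit[OF u w])
    moreover have "w \<xi> * nbsum u \<xi> - u \<xi> * nbsum w \<xi> = g \<xi> * w \<xi> - r \<xi>" for \<xi>
      by (simp add: r_def algebra_simps g(2)[symmetric])
    ultimately show "((\<lambda>R. (\<Sum>\<xi>\<in>zball R. of_real (tent R \<xi>) * r \<xi>) - (\<Sum>\<xi>\<in>zball R. of_real (tent R \<xi>) * (g \<xi> * w \<xi>))) \<longlongrightarrow> 0) at_top"
      by (simp add: right_diff_distrib sum_subtractf)
  qed simp
  ultimately show ?thesis by (simp add: r_def)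
qed

section \<open>Kernels given by three-term recurrences\<close>

text \<open>Balls are cofinal among finite sets, so unordered sums become limits of sequences, the
  form that dominated convergence requires.\<close>

lemma filterlim_zball: "filterlim (\<lambda>k. zball (real k) :: (int ^ 'n) set) (finite_subsets_at_top UNIV) sequentially"
  unfolding filterlim_finite_subsets_at_top
proof safe
  fix S :: "(int ^ 'n) set" assume S: "finite S"
  have "eventually (\<lambda>k. (\<Sum>\<xi>\<in>S. zn_norm \<xi>) \<le> real k) sequentially"
    using filterlim_real_sequentially unfolding filterlim_at_top by blast
  then show "eventually (\<lambda>k. finite (zball (real k) :: (int ^ 'n) set) \<and> S \<subseteq> zball (real k) \<and> (zball (real k) :: (int ^ 'n) set) \<subseteq> UNIV) sequentially"
  proof eventually_elim
    case (elim k)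
    have "\<xi> \<in> zball (real k)" if "\<xi> \<in> S" for \<xi>
      using member_le_sum[of \<xi> S zn_norm] that S elim by (auto simp: zball_def)
    then show ?case by auto
  qed
qed

lemma sum_zball_LIMSEQ:
  fixes a :: "int ^ 'n \<Rightarrow> complex"
  assumes "a summable_on UNIV"
  shows "(\<lambda>k. \<Sum>\<xi>\<in>zball (real k). a \<xi>) \<longlonglongrightarrow> infsum a UNIV"
  using has_sum_infsum[OF assms] filterlim_zball unfolding has_sum_def
  by (rule filterlim_compose)

text \<open>Dominated convergence: the partial sums are bounded by the constant
  \<open>infsum M UNIV\<close>, which is integrable on a probability space.\<close>

lemma infsum_integral_torus:
  fixes f :: "int ^ 'n \<Rightarrow> ('m::finite \<Rightarrow> real) \<Rightarrow> complex"
  assumes meas: "\<And>\<xi>. f \<xi> \<in> borel_measurable torus"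
    and bd: "\<And>\<xi> x. cmod (f \<xi> x) \<le> M \<xi>" and M: "M summable_on UNIV"
  shows "(\<lambda>x. \<Sum>\<^sub>\<infinity>\<xi>. f \<xi> x) \<in> borel_measurable torus"
    and "(\<Sum>\<^sub>\<infinity>\<xi>. \<integral>x. f \<xi> x \<partial>torus) = (\<integral>x. (\<Sum>\<^sub>\<infinity>\<xi>. f \<xi> x) \<partial>torus)"
proof -
  note [measurable] = meas
  have M0: "0 \<le> M \<xi>" for \<xi> using order_trans[OF norm_ge_zero bd] .
  have s1: "(\<lambda>\<xi>. f \<xi> x) summable_on UNIV" for x
    by (rule abs_summable_summable[OF summable_on_comparison_test[OF M bd]]) simp
  have s2: "(\<lambda>\<xi>. \<integral>x. f \<xi> x \<partial>torus) summable_on UNIV"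
    by (rule abs_summable_summable[OF summable_on_comparison_test[OF M norm_integral_torus_le[OF bd]]]) simp
  have lim1: "(\<lambda>k. \<Sum>\<xi>\<in>zball (real k). f \<xi> x) \<longlonglongrightarrow> (\<Sum>\<^sub>\<infinity>\<xi>. f \<xi> x)" for x
    by (rule sum_zball_LIMSEQ[OF s1])
  show meas_F: "(\<lambda>x. \<Sum>\<^sub>\<infinity>\<xi>. f \<xi> x) \<in> borel_measurable torus"
    by (rule borel_measurable_LIMSEQ_metric[OF _ lim1]) measurable
  interpret prob_space "torus :: ('m \<Rightarrow> real) measure" by (rule prob_space_torus)
  have "(\<lambda>k. \<integral>x. (\<Sum>\<xi>\<in>zball (real k). f \<xi> x) \<partial>torus) \<longlonglongrightarrow> (\<integral>x. (\<Sum>\<^sub>\<infinity>\<xi>. f \<xi> x) \<partial>torus)"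
  proof (rule integral_dominated_convergence[where w = "\<lambda>_. infsum M UNIV"])
    show "AE x in torus. cmod (\<Sum>\<xi>\<in>zball (real k). f \<xi> x) \<le> infsum M UNIV" for k
    proof (rule AE_I2)
      fix x :: "'m \<Rightarrow> real"
      have "cmod (\<Sum>\<xi>\<in>zball (real k). f \<xi> x) \<le> (\<Sum>\<xi>\<in>zball (real k). M \<xi>)"
        by (rule sum_norm_le[OF bd])
      also have "\<dots> \<le> infsum M UNIV" by (rule finite_sum_le_infsum[OF M]) (use M0 in auto)
      finally show "cmod (\<Sum>\<xi>\<in>zball (real k). f \<xi> x) \<le> infsum M UNIV" .
    qed
  qed (use meas_F lim1 in auto)
  moreover have "(\<integral>x. (\<Sum>\<xi>\<in>zball (real k). f \<xi> x) \<partial>torus) = (\<Sum>\<xi>\<in>zball (real k). \<integral>x. f \<xi> x \<partial>torus)" for k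
    by (rule Bochner_Integration.integral_sum) (rule integrable_torus_bounded[OF meas bd])
  ultimately show "(\<Sum>\<^sub>\<infinity>\<xi>. \<integral>x. f \<xi> x \<partial>torus) = (\<integral>x. (\<Sum>\<^sub>\<infinity>\<xi>. f \<xi> x) \<partial>torus)"
    using LIMSEQ_unique[OF sum_zball_LIMSEQ[OF s2]] by simp
qed

section \<open>Symbols and the kernels built from layer functions\<close>

definition symb :: "real \<Rightarrow> 'n::finite \<Rightarrow> ('n \<Rightarrow> complex) \<Rightarrow> complex" where
  "symb E j z = of_real E - 2 * (\<Sum>i\<in>-{j}. cos (z i))"

definition real_symb :: "real \<Rightarrow> 'n::finite \<Rightarrow> ('n \<Rightarrow> real) \<Rightarrow> real" where
  "real_symb E j x = E - 2 * (\<Sum>i\<in>-{j}. cos (x i))"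

lemma symb_of_real: "symb E j (\<lambda>i. of_real (x i)) = of_real (real_symb E j x)"
  by (simp add: symb_def real_symb_def cos_of_real)

lemma measurable_real_symb [measurable]: "real_symb E j \<in> borel_measurable torus"
  unfolding real_symb_def[abs_def] by measurable

lemma torus_char_axis: "torus_char j (axis l 1) z = (if l = j then 1 else exp (\<i> * z l))"
proof -
  have "(\<Sum>i\<in>-{j}. z i * of_int (axis l 1 $ i)) = (\<Sum>i\<in>-{j}. if i = l then z i else 0)"
    by (intro sum.cong) (auto simp: axis_def)
  also have "\<dots> = (if l = j then 0 else z l)" by (subst sum.delta) auto
  finally show ?thesis by (simp add: torus_char_def)
qed

lemma torus_char_minus_axis: "torus_char j (- axis l 1) z = (if l = j then 1 else exp (- (\<i> * z l)))"
proof -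
  have "torus_char j (- axis l 1) z = inverse (torus_char j (axis l 1) z)"
    by (simp add: torus_char_def sum_negf exp_minus)
  then show ?thesis by (simp add: torus_char_axis exp_minus)
qed

text \<open>On layer \<open>m\<close> the kernel \<open>w\<close> consists of Fourier coefficients
  of \<open>q m\<close>, and \<open>Q\<close> is the defect of \<open>q\<close> in the three-term
  recurrence. It is 0 for the localised Chebyshev family and lives on two layers for the signed
  powers of the small root.\<close>

context
  fixes q :: "int \<Rightarrow> ('n::finite \<Rightarrow> real) \<Rightarrow> complex" and C :: real and j :: 'n and E :: real
    and w :: "int ^ 'n \<Rightarrow> complex" and Q :: "int \<Rightarrow> ('n \<Rightarrow> real) \<Rightarrow> complex"
  assumes meas_q: "\<And>m. q m \<in> borel_measurable torus"
    and bound_q: "\<And>m x. cmod (q m x) \<le> C"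
    and w_def: "\<And>\<xi>. w \<xi> = (\<integral>x. real_char j \<xi> x * q (\<xi> $ j) x \<partial>torus)"
    and Q_def: "\<And>m x. Q m x = q (m + 1) x + q (m - 1) x - of_real (real_symb E j x) * q m x"
begin

lemma integrable_kernel: "integrable torus (\<lambda>x. real_char j \<xi> x * q m x)"
  by (rule integrable_torus_bounded[of _ C]) (use meas_q bound_q in \<open>auto simp: norm_mult\<close>)

text \<open>A pair of neighbours in a direction \<open>l \<noteq> j\<close> multiplies the integrand
  by \<open>2 * cos (x l)\<close>, while direction \<open>j\<close> only changes the layer, because
  the character ignores that coordinate.\<close>

lemma nbsum_kernel: "nbsum w \<xi> - of_real E * w \<xi> = (\<integral>x. real_char j \<xi> x * Q (\<xi> $ j) x \<partial>torus)"
proof -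
  define f where "f = (\<lambda>l x. real_char j (\<xi> + axis l 1) x * q ((\<xi> + axis l 1) $ j) x
      + real_char j (\<xi> - axis l 1) x * q ((\<xi> - axis l 1) $ j) x)"
  have intf: "integrable torus (f l)" for l
    unfolding f_def by (intro Bochner_Integration.integrable_add integrable_kernel)
  have "nbsum w \<xi> = (\<Sum>l\<in>UNIV. integral\<^sup>L torus (f l))"
    unfolding nbsum_def w_def f_def
    by (subst Bochner_Integration.integral_add) (simp_all add: integrable_kernel)
  also have "\<dots> = (\<integral>x. (\<Sum>l\<in>UNIV. f l x) \<partial>torus)"
    by (rule Bochner_Integration.integral_sum[symmetric]) (rule intf)
  finally have "nbsum w \<xi> - of_real E * w \<xi> =
      (\<integral>x. (\<Sum>l\<in>UNIV. f l x) \<partial>torus) - (\<integral>x. of_real E * (real_char j \<xi> x * q (\<xi> $ j) x) \<partial>torus)"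
    by (simp add: w_def)
  also have "\<dots> = (\<integral>x. (\<Sum>l\<in>UNIV. f l x) - of_real E * (real_char j \<xi> x * q (\<xi> $ j) x) \<partial>torus)"
    by (rule Bochner_Integration.integral_diff[symmetric])
       (intro Bochner_Integration.integrable_sum intf, intro integrable_mult_right integrable_kernel)
  also have "\<dots> = (\<integral>x. real_char j \<xi> x * Q (\<xi> $ j) x \<partial>torus)"
  proof (rule Bochner_Integration.integral_cong[OF refl])
    fix x
    have fj: "f j x = real_char j \<xi> x * (q (\<xi> $ j + 1) x + q (\<xi> $ j - 1) x)"
      by (simp add: f_def torus_char_add[of _ _ "- _", simplified] torus_char_add torus_char_axis torus_char_minus_axis algebra_simps)
    have fl: "f l x = real_char j \<xi> x * q (\<xi> $ j) x * (2 * cos (of_real (x l)))" if "l \<noteq> j" for l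
    proof -
      have "axis l (1::int) $ j = 0" using that by (simp add: axis_def)
      then show ?thesis
        using that
        by (simp add: f_def torus_char_add[of _ _ "- _", simplified] torus_char_add torus_char_axis torus_char_minus_axis cos_exp_eq
            algebra_simps)
    qed
    have "(\<Sum>l\<in>UNIV. f l x) = f j x + (\<Sum>l\<in>-{j}. f l x)"
      by (subst sum.remove[of UNIV j]) (auto simp: Compl_eq_Diff_UNIV)
    also have "(\<Sum>l\<in>-{j}. f l x) = real_char j \<xi> x * q (\<xi> $ j) x * (2 * (\<Sum>l\<in>-{j}. cos (of_real (x l))))"
    proof -
      have "(\<Sum>l\<in>-{j}. f l x) = (\<Sum>l\<in>-{j}. real_char j \<xi> x * q (\<xi> $ j) x * (2 * cos (of_real (x l))))"
        by (rule sum.cong) (auto simp: fl)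
      then show ?thesis by (simp only: sum_distrib_left)
    qed
    finally show "(\<Sum>l\<in>UNIV. f l x) - of_real E * (real_char j \<xi> x * q (\<xi> $ j) x) = real_char j \<xi> x * Q (\<xi> $ j) x"
      by (simp add: fj Q_def real_symb_def cos_of_real algebra_simps)
  qed
  finally show ?thesis .
qed

lemma norm_kernel_le: "cmod (w \<xi>) \<le> C"
  unfolding w_def by (rule norm_integral_torus_le) (simp add: norm_mult bound_q)

text \<open>Bessel's inequality allows \<open>C\<^sup>2\<close> per layer, and the ball meets at
  most \<open>2 * \<lceil>R\<rceil> + 1 \<le> 3 * (R + 1)\<close> layers.\<close>

lemma kernel_l2_bound:
  assumes R: "R \<ge> 0"
  shows "(\<Sum>\<xi>\<in>zball R. (cmod (w \<xi>))\<^sup>2) \<le> 3 * C\<^sup>2 * (R + 1)"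
proof -
  define J where "J = {-\<lceil>R\<rceil>..\<lceil>R\<rceil>}"
  have "(\<lambda>\<xi>. \<xi> $ j) ` zball R \<subseteq> J"
  proof clarify
    fix \<xi> :: "int ^ 'n" assume "\<xi> \<in> zball R"
    then have "\<bar>real_of_int (\<xi> $ j)\<bar> \<le> R"
      using component_le_zn_norm[of \<xi> j] by (simp add: zball_def)
    then show "\<xi> $ j \<in> J" unfolding J_def abs_le_iff atLeastAtMost_iff by linarith
  qed
  then have "(\<Sum>\<xi>\<in>zball R. (cmod (w \<xi>))\<^sup>2) = (\<Sum>m\<in>J. \<Sum>\<xi>\<in>{\<xi> \<in> zball R. \<xi> $ j = m}. (cmod (w \<xi>))\<^sup>2)"
    by (intro sum.group[symmetric]) (auto simp: J_def)
  also have "\<dots> \<le> (\<Sum>m\<in>J. C\<^sup>2)"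
  proof (rule sum_mono)
    fix m
    have "(\<Sum>\<xi>\<in>{\<xi> \<in> zball R. \<xi> $ j = m}. (cmod (w \<xi>))\<^sup>2) =
        (\<Sum>\<xi>\<in>{\<xi> \<in> zball R. \<xi> $ j = m}. (cmod (\<integral>x. real_char j \<xi> x * q m x \<partial>torus))\<^sup>2)"
      by (rule sum.cong) (auto simp: w_def)
    also have "\<dots> \<le> C\<^sup>2"
      by (rule bessel_torus[where m = m]) (auto simp: meas_q bound_q)
    finally show "(\<Sum>\<xi>\<in>{\<xi> \<in> zball R. \<xi> $ j = m}. (cmod (w \<xi>))\<^sup>2) \<le> C\<^sup>2" .
  qed
  also have "\<dots> = (2 * real_of_int \<lceil>R\<rceil> + 1) * C\<^sup>2"
  proof -
    have "0 \<le> \<lceil>R\<rceil>" using R by simp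
    then have "real (card J) = 2 * real_of_int \<lceil>R\<rceil> + 1"
      unfolding J_def by (simp only: card_atLeastAtMost_int)
    then show ?thesis by simp
  qed
  also have "\<dots> \<le> (3 * (R + 1)) * C\<^sup>2"
    using R of_int_ceiling_le_add_one[of R] by (intro mult_right_mono) (auto, linarith)
  finally show ?thesis by (simp only: mult_ac)
qed

text \<open>Green's formula for \<open>w\<close>, with the lattice sum moved under the torus
  integral so that it can be analysed pointwise in \<open>x\<close>.\<close>

lemma kernel_pairing:
  fixes u g :: "int ^ 'n \<Rightarrow> complex"
  assumes u: "small_average u"
    and g: "superexp g" "\<And>\<xi>. nbsum u \<xi> - of_real E * u \<xi> = g \<xi>"
    and F: "finite F" "\<And>\<xi>. \<xi> \<notin> F \<Longrightarrow> (\<integral>x. real_char j \<xi> x * Q (\<xi> $ j) x \<partial>torus) = 0"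
  shows "(\<integral>x. (\<Sum>\<^sub>\<infinity>\<xi>. g \<xi> * (real_char j \<xi> x * q (\<xi> $ j) x)) \<partial>torus) =
    (\<Sum>\<xi>\<in>F. u \<xi> * (\<integral>x. real_char j \<xi> x * Q (\<xi> $ j) x \<partial>torus))"
proof -
  have "(\<Sum>\<^sub>\<infinity>\<xi>. g \<xi> * w \<xi>) = (\<Sum>\<xi>\<in>F. u \<xi> * (nbsum w \<xi> - of_real E * w \<xi>))"
    using u g kernel_l2_bound norm_kernel_le F(1)
    by (rule green_pairing) (assumption, subst nbsum_kernel, rule F(2))
  also have "(\<Sum>\<^sub>\<infinity>\<xi>. g \<xi> * w \<xi>) = (\<Sum>\<^sub>\<infinity>\<xi>. \<integral>x. g \<xi> * (real_char j \<xi> x * q (\<xi> $ j) x) \<partial>torus)"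
    by (simp add: w_def)
  also have "\<dots> = (\<integral>x. (\<Sum>\<^sub>\<infinity>\<xi>. g \<xi> * (real_char j \<xi> x * q (\<xi> $ j) x)) \<partial>torus)"
  proof (rule infsum_integral_torus(2))
    show "(\<lambda>\<xi>. C * (cmod (g \<xi>) * exp (0 * l1norm \<xi>))) summable_on UNIV"
      by (intro summable_on_cmult_right superexp_summable g)
    show "cmod (g \<xi> * (real_char j \<xi> x * q (\<xi> $ j) x)) \<le> C * (cmod (g \<xi>) * exp (0 * l1norm \<xi>))" for \<xi> x
      using mult_left_mono[OF bound_q[of "\<xi> $ j" x], of "cmod (g \<xi>)"] by (simp add: norm_mult mult_ac)
  qed (use meas_q in measurable)
  finally show ?thesis by (simp only: nbsum_kernel)
qed

end

section \<open>Vanishing on the Fermi surface\<close>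

text \<open>\<open>cheb_nat (2 cos \<theta>) n = sin (n \<theta>) / sin \<theta>\<close>, that is \<open>U\<^bsub>n-1\<^esub>(t/2)\<close>; \<open>cheb_int\<close> is its odd extension.\<close>

fun cheb_nat :: "complex \<Rightarrow> nat \<Rightarrow> complex" where
  "cheb_nat t 0 = 0"
| "cheb_nat t (Suc 0) = 1"
| "cheb_nat t (Suc (Suc n)) = t * cheb_nat t (Suc n) - cheb_nat t n"

definition cheb_int :: "complex \<Rightarrow> int \<Rightarrow> complex" where
  "cheb_int t m = (if m \<ge> 0 then cheb_nat t (nat m) else - cheb_nat t (nat (- m)))"

text \<open>Oddness carries the recurrence through \<open>m = 0\<close>, where both sides vanish;
  the negative side mirrors the positive one.\<close>

lemma cheb_int_recurrence: "cheb_int t (m + 1) + cheb_int t (m - 1) = t * cheb_int t m"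
proof -
  consider "m = 0" | n where "m = int (Suc n)" | n where "m = - int (Suc n)"
    by (cases m rule: int_cases3) (metis gr0_implies_Suc)+
  then show ?thesis
  proof cases
    case 2
    then have "nat (m + 1) = Suc (Suc n)" "nat (m - 1) = n" "nat m = Suc n" "m \<ge> 1" by auto
    then show ?thesis by (simp add: cheb_int_def)
  next
    case (3 n)
    then have "nat (- (m - 1)) = Suc (Suc n)" "nat (- (m + 1)) = n" "nat (- m) = Suc n" "m \<le> -1" by auto
    then show ?thesis by (cases "m = -1") (auto simp: cheb_int_def numeral_2_eq_2)
  qed (simp add: cheb_int_def)
qed


text \<open>Crude but valid for all complex \<open>t\<close>: exponential growth in the index is
  harmless against the decay of \<open>g\<close>.\<close>

lemma norm_cheb_nat_le: "cmod (cheb_nat t n) \<le> (1 + cmod t) ^ n"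
proof (induction t n rule: cheb_nat.induct)
  case (3 t n)
  have "cmod (cheb_nat t (Suc (Suc n))) \<le> cmod t * cmod (cheb_nat t (Suc n)) + cmod (cheb_nat t n)"
    by (simp add: norm_triangle_ineq4 norm_mult[symmetric])
  also have "\<dots> \<le> cmod t * (1 + cmod t) ^ Suc n + (1 + cmod t) ^ n"
    using 3 by (intro add_mono mult_left_mono) auto
  also have "\<dots> \<le> cmod t * (1 + cmod t) ^ Suc n + (1 + cmod t) ^ Suc n"
    by (intro add_left_mono power_increasing) auto
  also have "\<dots> = (1 + cmod t) ^ Suc (Suc n)" by (simp add: algebra_simps)
  finally show ?case .
qed auto

lemma norm_cheb_int_le: "cmod (cheb_int t m) \<le> (1 + cmod t) ^ nat \<bar>m\<bar>"
  using norm_cheb_nat_le[of t "nat m"] norm_cheb_nat_le[of t "nat (- m)"] by (auto simp: cheb_int_def)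

lemma cheb_nat_trig:
  "cheb_nat (of_real (2 * cos \<theta>)) n * of_real (sin \<theta>) = of_real (sin (real n * \<theta>))"
proof (induction n rule: induct_nat_012)
  case (ge2 n)
  have "sin (real (Suc (Suc n)) * \<theta>) = 2 * cos \<theta> * sin (real (Suc n) * \<theta>) - sin (real n * \<theta>)"
    using sin_add[of "real (Suc n) * \<theta>" \<theta>] sin_diff[of "real (Suc n) * \<theta>" \<theta>]
    by (simp add: algebra_simps)
  then show ?case using ge2 by (simp add: left_diff_distrib mult.assoc del: of_nat_Suc)
qed auto

text \<open>With \<open>s = 2 * cos \<theta>\<close> the value times \<open>sin \<theta>\<close> is
  a sine, and \<open>sin \<theta>\<close> stays away from 0 when
  \<open>\<bar>s\<bar> \<le> \<tau> < 2\<close>. Uniformity in \<open>m\<close> is what makes the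
  family an admissible kernel.\<close>

lemma norm_cheb_int_real_le:
  assumes s: "\<bar>s\<bar> \<le> \<tau>" and \<tau>: "\<tau> < 2"
  shows "cmod (cheb_int (of_real s) m) \<le> 1 / sqrt (1 - (\<tau> / 2)\<^sup>2)"
proof -
  define \<theta> where "\<theta> = arccos (s / 2)"
  have c: "2 * cos \<theta> = s" using s \<tau> by (simp add: \<theta>_def)
  have sn: "sin \<theta> = sqrt (1 - (s / 2)\<^sup>2)"
    unfolding \<theta>_def using s \<tau> by (intro sin_arccos) auto
  have "(s / 2)\<^sup>2 \<le> (\<tau> / 2)\<^sup>2" using s by (simp add: abs_le_square_iff[symmetric] power_divide divide_right_mono)
  then have le: "sqrt (1 - (\<tau> / 2)\<^sup>2) \<le> sin \<theta>" unfolding sn by simp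
  have pos: "0 < sqrt (1 - (\<tau> / 2)\<^sup>2)"
  proof -
    have "(\<tau> / 2)\<^sup>2 < 1\<^sup>2" using s \<tau> by (intro power_strict_mono) auto
    then show ?thesis by simp
  qed
  have "cmod (cheb_nat (of_real s) n) \<le> 1 / sqrt (1 - (\<tau> / 2)\<^sup>2)" for n
  proof -
    have "cmod (cheb_nat (of_real s) n) * sqrt (1 - (\<tau> / 2)\<^sup>2) \<le> cmod (cheb_nat (of_real s) n) * \<bar>sin \<theta>\<bar>"
      using le by (intro mult_left_mono) auto
    also have "\<dots> = \<bar>sin (real n * \<theta>)\<bar>"
      using arg_cong[OF cheb_nat_trig[of \<theta> n], of cmod] by (simp only: c norm_mult norm_of_real)
    also have "\<dots> \<le> 1" by simp
    finally show ?thesis using pos by (simp add: pos_le_divide_eq)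
  qed
  then show ?thesis by (simp add: cheb_int_def)
qed

lemma holomorphic_on_cheb_nat: "h holomorphic_on A \<Longrightarrow> (\<lambda>s. cheb_nat (h s) n) holomorphic_on A"
  by (induction n rule: induct_nat_012) (auto intro!: holomorphic_intros)

lemma holomorphic_on_cheb_int: "h holomorphic_on A \<Longrightarrow> (\<lambda>s. cheb_int (h s) m) holomorphic_on A"
  by (cases "m \<ge> 0") (auto simp: cheb_int_def intro!: holomorphic_intros holomorphic_on_cheb_nat)

lemma continuous_on_cheb_nat:
  fixes h :: "'a::topological_space \<Rightarrow> complex"
  shows "continuous_on A h \<Longrightarrow> continuous_on A (\<lambda>s. cheb_nat (h s) n)"
  by (induction n rule: induct_nat_012) (auto intro!: continuous_intros)

lemma continuous_on_cheb_int:
  fixes h :: "'a::topological_space \<Rightarrow> complex"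
  shows "continuous_on A h \<Longrightarrow> continuous_on A (\<lambda>s. cheb_int (h s) m)"
  by (cases "m \<ge> 0") (auto simp: cheb_int_def intro!: continuous_intros continuous_on_cheb_nat)

lemma measurable_cheb_int [measurable]: "(\<lambda>t. cheb_int t m) \<in> borel_measurable borel"
  by (intro borel_measurable_continuous_onI continuous_on_cheb_int continuous_on_id)

text \<open>The pairing of \<open>g\<close> with the solution that vanishes on layer
  \<open>p\<close>. Its terms are polynomials in the symbol times exponentials, so no branch of a
  root is chosen; \<open>p = 0\<close> and \<open>p = 1\<close> give a basis of the
  solutions.\<close>

definition fermi :: "real \<Rightarrow> 'n::finite \<Rightarrow> (int ^ 'n \<Rightarrow> complex) \<Rightarrow> int \<Rightarrow> ('n \<Rightarrow> complex) \<Rightarrow> complex" where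
  "fermi E j g p z = (\<Sum>\<^sub>\<infinity>\<xi>. g \<xi> * (torus_char j \<xi> z * cheb_int (symb E j z) (\<xi> $ j - p)))"

lemma power_le_exp_l1norm:
  assumes "0 \<le> \<tau>"
  shows "(1 + \<tau>) ^ nat \<bar>\<xi> $ j - p\<bar> \<le> (1 + \<tau>) ^ nat \<bar>p\<bar> * exp (ln (1 + \<tau>) * l1norm \<xi>)"
proof -
  have "(1 + \<tau>) ^ nat \<bar>\<xi> $ j - p\<bar> \<le> (1 + \<tau>) ^ (nat \<bar>p\<bar> + nat \<bar>\<xi> $ j\<bar>)"
    using assms by (intro power_increasing) auto
  also have "\<dots> = (1 + \<tau>) ^ nat \<bar>p\<bar> * (1 + \<tau>) ^ nat \<bar>\<xi> $ j\<bar>" by (simp add: power_add)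
  also have "(1 + \<tau>) ^ nat \<bar>\<xi> $ j\<bar> = exp (ln (1 + \<tau>) * \<bar>real_of_int (\<xi> $ j)\<bar>)"
  proof -
    have "(1 + \<tau>) ^ nat \<bar>\<xi> $ j\<bar> = exp (real (nat \<bar>\<xi> $ j\<bar>) * ln (1 + \<tau>))"
      by (subst exp_of_nat_mult) (use assms in simp)
    moreover have "real (nat \<bar>\<xi> $ j\<bar>) = \<bar>real_of_int (\<xi> $ j)\<bar>" by simp
    ultimately show ?thesis by (simp only: mult.commute)
  qed
  also have "\<dots> \<le> exp (ln (1 + \<tau>) * l1norm \<xi>)"
    using assms component_le_l1norm[of \<xi> j] by (simp add: mult_left_mono)
  finally show ?thesis using assms by (simp add: mult_left_mono)
qed

lemma fermi_term_le:
  assumes M: "\<And>i. \<bar>Im (z i)\<bar> \<le> M" and \<tau>: "cmod (symb E j z) \<le> \<tau>"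
  shows "cmod (g \<xi> * (torus_char j \<xi> z * cheb_int (symb E j z) (\<xi> $ j - p)))
    \<le> (1 + \<tau>) ^ nat \<bar>p\<bar> * (cmod (g \<xi>) * exp ((M + ln (1 + \<tau>)) * l1norm \<xi>))"
proof -
  have \<tau>0: "0 \<le> \<tau>" using order_trans[OF norm_ge_zero \<tau>] .
  have "cmod (cheb_int (symb E j z) (\<xi> $ j - p)) \<le> (1 + cmod (symb E j z)) ^ nat \<bar>\<xi> $ j - p\<bar>"
    by (rule norm_cheb_int_le)
  also have "\<dots> \<le> (1 + \<tau>) ^ nat \<bar>\<xi> $ j - p\<bar>" using \<tau> by (intro power_mono) auto
  also note power_le_exp_l1norm[OF \<tau>0]
  finally have "cmod (g \<xi> * (torus_char j \<xi> z * cheb_int (symb E j z) (\<xi> $ j - p))) \<le>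
      cmod (g \<xi>) * (exp (M * l1norm \<xi>) * ((1 + \<tau>) ^ nat \<bar>p\<bar> * exp (ln (1 + \<tau>) * l1norm \<xi>)))"
    unfolding norm_mult by (intro mult_left_mono mult_mono norm_torus_char_le M) auto
  also have "\<dots> = (1 + \<tau>) ^ nat \<bar>p\<bar> * (cmod (g \<xi>) * exp ((M + ln (1 + \<tau>)) * l1norm \<xi>))"
    by (simp only: distrib_right exp_add) (simp only: mult_ac)
  finally show ?thesis .
qed

lemma abs_real_symb_le: "\<bar>real_symb E (j::'n::finite) x\<bar> \<le> \<bar>E\<bar> + 2 * real CARD('n)"
proof -
  have "\<bar>\<Sum>i\<in>-{j}. cos (x i)\<bar> \<le> (\<Sum>i\<in>-{j}. 1)"
    by (rule order_trans[OF sum_abs sum_mono]) simp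
  also have "\<dots> \<le> real CARD('n)" by (simp add: card_mono)
  finally show ?thesis unfolding real_symb_def by linarith
qed

text \<open>The symbol is bounded on the real torus, so this majorant does not depend on
  \<open>x\<close> and serves the M-test and Fubini alike.\<close>

lemma norm_fermi_real_term_le:
  fixes j :: "'n::finite" and E :: real
  defines "\<tau> \<equiv> \<bar>E\<bar> + 2 * real CARD('n)"
  shows "cmod (g \<xi> * (real_char j \<xi> x * cheb_int (of_real (real_symb E j x)) (\<xi> $ j - p)))
    \<le> (1 + \<tau>) ^ nat \<bar>p\<bar> * (cmod (g \<xi>) * exp (ln (1 + \<tau>) * l1norm \<xi>))"
  using fermi_term_le[of "\<lambda>i. of_real (x i)" 0 E j \<tau> g \<xi> p] abs_real_symb_le[of E j x]
  by (simp add: symb_of_real \<tau>_def)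

lemma continuous_on_real_symb: "continuous_on UNIV (real_symb E j)"
  unfolding real_symb_def[abs_def] by (intro continuous_intros continuous_on_product_coordinates)

lemma continuous_on_fermi_real:
  assumes "superexp g"
  shows "continuous_on UNIV (\<lambda>x :: 'n::finite \<Rightarrow> real. fermi E j g p (\<lambda>i. of_real (x i)))"
proof (rule uniform_limit_theorem)
  show "uniform_limit UNIV (\<lambda>S x. \<Sum>\<xi>\<in>S. g \<xi> * (real_char j \<xi> x * cheb_int (of_real (real_symb E j x)) (\<xi> $ j - p)))
    (\<lambda>x :: 'n \<Rightarrow> real. fermi E j g p (\<lambda>i. of_real (x i))) (finite_subsets_at_top UNIV)"
    unfolding fermi_def symb_of_real
    by (rule Weierstrass_m_test_general[OF norm_fermi_real_term_le])
       (intro summable_on_cmult_right superexp_summable assms)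
  show "\<forall>\<^sub>F S in finite_subsets_at_top UNIV. continuous_on UNIV
      (\<lambda>x. \<Sum>\<xi>\<in>S. g \<xi> * (real_char j \<xi> x * cheb_int (of_real (real_symb E j x)) (\<xi> $ j - p)))"
    unfolding torus_char_def
    by (intro always_eventually allI continuous_intros continuous_on_cheb_int continuous_on_real_symb
        continuous_on_product_coordinates)
qed simp

text \<open>A point interior to the interval carrying \<open>circ\<close> has a nondegenerate
  interval around it inside \<open>X\<close>.\<close>

lemma emeasure_circ_open_pos:
  assumes "open X" "x \<in> X" "0 < x" "x < 2 * pi"
  shows "emeasure circ X \<noteq> 0"
proof -
  have "open (X \<inter> {0<..<2 * pi})" using assms by (intro open_Int) auto
  then obtain d where d: "d > 0" "ball x d \<subseteq> X \<inter> {0<..<2 * pi}"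
    using assms by (metis IntI greaterThanLessThan_iff open_contains_ball)
  have "{x..x + d / 2} \<subseteq> ball x d" using d(1) by (auto simp: dist_real_def)
  then have sub: "{x..x + d / 2} \<subseteq> {0..2 * pi} \<inter> X" using d(2) by force
  have "emeasure lborel {x..x + d / 2} \<le> emeasure lborel ({0..2 * pi} \<inter> X)"
    using assms(1) by (intro emeasure_mono sub) auto
  moreover have "emeasure lborel {x..x + d / 2} > 0" using d(1) by simp
  ultimately have "emeasure lborel ({0..2 * pi} \<inter> X) \<noteq> 0" by auto
  then show ?thesis
    unfolding circ_def using assms(1)
    by (subst emeasure_uniform_measure) (auto simp: ennreal_divide_eq_0_iff)
qed

text \<open>Where \<open>\<bar>t\<bar> < 2\<close> the Chebyshev family is bounded. Multiplied by
  the indicator of a small box \<open>B\<close> in \<open>x\<close> it still solves the recurrence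
  in \<open>m\<close>, so the pairing has no source and \<open>F\<close> integrates to 0 over
  \<open>B\<close>. Continuity then rules out \<open>F x1 \<noteq> 0\<close>.\<close>

lemma fermi_eq_0_elliptic:
  fixes u g :: "int ^ 'n::finite \<Rightarrow> complex"
  assumes u: "small_average u"
    and g: "superexp g" "\<And>\<xi>. nbsum u \<xi> - of_real E * u \<xi> = g \<xi>"
    and x1: "\<And>i. 0 < x1 i" "\<And>i. x1 i < 2 * pi" "\<bar>real_symb E j x1\<bar> < \<tau>" and \<tau>: "\<tau> < 2"
  shows "fermi E j g p (\<lambda>i. of_real (x1 i)) = 0"
proof (rule ccontr)
  assume nz: "fermi E j g p (\<lambda>i. of_real (x1 i)) \<noteq> 0"
  define F where "F = (\<lambda>x :: 'n \<Rightarrow> real. fermi E j g p (\<lambda>i. of_real (x i)))"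
  \<comment> \<open>Within half of \<open>\<bar>F x1\<bar>\<close> of the value at
    \<open>x1\<close>, the function cannot average to 0.\<close>
  define \<epsilon> where "\<epsilon> = cmod (F x1) / 2"
  have \<epsilon>: "0 < \<epsilon>" using nz by (simp add: \<epsilon>_def F_def)
  define U where "U = {x. \<bar>real_symb E j x\<bar> < \<tau>} \<inter> {x. dist (F x) (F x1) < \<epsilon>}"
  have cF: "continuous_on UNIV F" unfolding F_def by (rule continuous_on_fermi_real[OF g(1)])
  have "open U" unfolding U_def
    by (intro open_Int open_Collect_less continuous_intros continuous_on_real_symb cF)
  moreover have "x1 \<in> U" using x1(3) \<epsilon> by (simp add: U_def)
  \<comment> \<open>A basic open box is chosen inside \<open>U\<close>, because its mass is a
    product of circle masses.\<close>
  ultimately obtain X where X: "x1 \<in> PiE UNIV X" "\<And>i. open (X i)" "PiE UNIV X \<subseteq> U"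
    using product_topology_open_contains_basis[of "\<lambda>_. euclidean" UNIV U x1]
    by (auto simp: open_fun_def)
  define B where "B = PiE UNIV X"
  interpret P: product_sigma_finite "\<lambda>_::'n. circ"
    by (rule product_sigma_finite.intro) (rule prob_space_imp_sigma_finite[OF prob_space_circ])
  interpret T: prob_space "torus :: ('n \<Rightarrow> real) measure" by (rule prob_space_torus)
  have B_sets [measurable]: "B \<in> sets torus"
    unfolding B_def torus_def using X(2) by (intro sets_PiM_I_finite) auto
  have "emeasure torus B = (\<Prod>i\<in>UNIV. emeasure circ (X i))"
    unfolding B_def torus_def using X(2) by (intro P.emeasure_PiM) auto
  also have "\<dots> \<noteq> 0"
  proof -
    have "emeasure circ (X i) \<noteq> 0" for i
      using emeasure_circ_open_pos[of "X i" "x1 i"] X(1,2) x1 by auto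
    then show ?thesis by (simp add: prod_zero_iff)
  qed
  finally have \<mu>: "0 < measure torus B"
    by (simp add: T.emeasure_eq_measure zero_less_measure_iff)
  define K where "K = 1 / sqrt (1 - (\<tau> / 2)\<^sup>2)"
  have K0: "0 \<le> K" using norm_cheb_int_real_le[of 0 \<tau> 0] x1(3) \<tau> order_trans[OF norm_ge_zero]
    unfolding K_def by fastforce
  define q where "q = (\<lambda>m x. indicator B x * cheb_int (of_real (real_symb E j x)) (m - p))"
  have mq: "q m \<in> borel_measurable torus" for m unfolding q_def by measurable
  have bq: "cmod (q m x) \<le> K" for m x
  proof (cases "x \<in> B")
    case True
    then have "\<bar>real_symb E j x\<bar> < \<tau>" using X(3) by (auto simp: B_def U_def)
    then show ?thesis unfolding q_def K_def using True \<tau> by (simp add: norm_cheb_int_real_le)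
  qed (simp add: q_def K0)
  have Q0: "q (m + 1) x + q (m - 1) x - of_real (real_symb E j x) * q m x = 0" for m x
    using cheb_int_recurrence[of "of_real (real_symb E j x)" "m - p"]
    by (simp add: q_def algebra_simps flip: distrib_left)
  have "(\<integral>x. (\<Sum>\<^sub>\<infinity>\<xi>. g \<xi> * (real_char j \<xi> x * q (\<xi> $ j) x)) \<partial>torus) = (\<Sum>\<xi>\<in>{}. u \<xi> * (\<integral>x. real_char j \<xi> x * 0 \<partial>torus))"
    by (rule kernel_pairing[where q = q and C = K and E = E and w = "\<lambda>\<xi>. \<integral>x. real_char j \<xi> x * q (\<xi> $ j) x \<partial>torus"])
       (use mq bq Q0 u g in auto)
  also have "(\<lambda>x. (\<Sum>\<^sub>\<infinity>\<xi>. g \<xi> * (real_char j \<xi> x * q (\<xi> $ j) x))) = (\<lambda>x. indicator B x * F x)"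
    by (intro ext) (simp add: F_def fermi_def symb_of_real q_def mult_ac flip: infsum_cmult_right')
  finally have zero: "(\<integral>x. indicator B x * F x \<partial>torus) = 0" by simp
  have dF: "cmod (F x1 - F x) \<le> \<epsilon>" if "x \<in> B" for x
    using that X(3) by (force simp: B_def U_def dist_norm norm_minus_commute)
  have mF: "F \<in> borel_measurable torus"
    unfolding F_def fermi_def symb_of_real
    by (rule infsum_integral_torus(1)[OF _ norm_fermi_real_term_le])
       (measurable, intro summable_on_cmult_right superexp_summable g)
  note [measurable] = mF
  have bF: "cmod (F x) \<le> cmod (F x1) + \<epsilon>" if "x \<in> B" for x
    using dF[OF that] norm_triangle_ineq3[of "F x" "F x1"] by (simp add: norm_minus_commute)
  have i1: "integrable torus (\<lambda>x. indicator B x * F x)"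
    by (rule integrable_torus_bounded[of _ "cmod (F x1) + \<epsilon>"])
       (use bF \<epsilon> in \<open>auto simp: norm_mult split: split_indicator intro: add_nonneg_nonneg\<close>)
  have i2: "integrable torus (\<lambda>x. indicator B x * F x1 :: complex)"
    by (rule integrable_torus_bounded[of _ "cmod (F x1)"])
       (auto simp: norm_mult split: split_indicator)
  have "of_real (measure torus B) * F x1 = (\<integral>x. indicator B x *\<^sub>R F x1 \<partial>torus)"
    by (simp add: scaleR_conv_of_real)
  also have "\<dots> = (\<integral>x. indicator B x * F x1 \<partial>torus)"
    by (intro Bochner_Integration.integral_cong refl) (simp split: split_indicator)
  also have "\<dots> = (\<integral>x. indicator B x * F x1 \<partial>torus) - (\<integral>x. indicator B x * F x \<partial>torus)"
    using zero by simp
  also have "\<dots> = (\<integral>x. indicator B x * F x1 - indicator B x * F x \<partial>torus)"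
    using i1 i2 by simp
  finally have "measure torus B * cmod (F x1) = cmod (\<integral>x. indicator B x * F x1 - indicator B x * F x \<partial>torus)"
    by (metis norm_mult norm_of_real abs_of_nonneg measure_nonneg)
  also have "\<dots> \<le> (\<integral>x. cmod (indicator B x * F x1 - indicator B x * F x) \<partial>torus)"
    by simp
  also have "\<dots> \<le> (\<integral>x. indicator B x * \<epsilon> \<partial>torus)"
  proof (rule integral_mono)
    show "integrable torus (\<lambda>x. cmod (indicator B x * F x1 - indicator B x * F x))"
      using i1 i2 by (intro integrable_norm Bochner_Integration.integrable_diff)
    show "cmod (indicator B x * F x1 - indicator B x * F x) \<le> indicator B x * \<epsilon>" for x
      using dF[of x] by (auto split: split_indicator)
    show "integrable torus (\<lambda>x. indicator B x * \<epsilon>)"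
      by (intro integrable_mult_left integrable_real_indicator) (simp_all add: T.emeasure_eq_measure)
  qed
  also have "\<dots> = measure torus B * \<epsilon>" by simp
  finally have "cmod (F x1) \<le> \<epsilon>" using \<mu> by simp
  then show False using \<epsilon> by (simp add: \<epsilon>_def)
qed

text \<open>The zero set is propagated along the complex line through \<open>y\<close> and a point \<open>(\<theta>, \<dots>, \<theta>)\<close>
  at which the symbol equals \<open>E / n\<close>, hence lies in \<open>(- 2, 2)\<close>.\<close>

lemma fermi_eq_0:
  fixes u g :: "int ^ 'n::finite \<Rightarrow> complex"
  assumes u: "small_average u"
    and g: "superexp g" "\<And>\<xi>. nbsum u \<xi> - of_real E * u \<xi> = g \<xi>"
    and E: "\<bar>E\<bar> < 2 * real CARD('n)"
  shows "fermi E j g p (\<lambda>i. of_real (y i)) = 0"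
proof -
  define n where "n = real CARD('n)"
  have n: "n > 0" by (simp add: n_def)
  have cE: "\<bar>E / (2 * n)\<bar> < 1" using E n by (simp add: n_def divide_simps)
  \<comment> \<open>As \<open>E / (2 * n)\<close> lies strictly between -1 and 1,
    \<open>\<theta>\<close> is interior to the interval carrying \<open>circ\<close>.\<close>
  define \<theta> where "\<theta> = arccos (E / (2 * n))"
  have cE': "-1 < E / (2 * n)" "E / (2 * n) < 1" using cE unfolding abs_less_iff by linarith+
  then have \<theta>: "0 < \<theta>" "\<theta> < pi" using arccos_lt_bounded by (auto simp only: \<theta>_def)
  \<comment> \<open>\<open>X\<close> runs along the real segment from the constant point at
    \<open>s = 0\<close> to \<open>y\<close> at \<open>s = 1\<close>; \<open>z\<close> is its
    complexification.\<close>
  define X where "X = (\<lambda>(s::real) (i::'n). \<theta> + s * (y i - \<theta>))"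
  define z where "z = (\<lambda>s (i::'n). complex_of_real \<theta> + s * of_real (y i - \<theta>))"
  \<comment> \<open>The midpoint of \<open>\<bar>E\<bar> / n\<close> and 2 leaves room on both
    sides.\<close>
  define \<tau> where "\<tau> = (2 + \<bar>E\<bar> / n) / 2"
  have \<tau>: "\<bar>E\<bar> / n < \<tau>" "\<tau> < 2"
    using E n by (auto simp: \<tau>_def n_def divide_simps)
  have r0: "real_symb E j (X 0) = E / n"
  proof -
    have "cos \<theta> = E / (2 * n)" unfolding \<theta>_def using cE' by (intro cos_arccos) auto
    moreover have "real (card (- {j})) = n - 1"
      by (simp add: n_def Compl_eq_Diff_UNIV card_Diff_singleton of_nat_diff)
    ultimately have "real_symb E j (X 0) = E - 2 * ((n - 1) * (E / (2 * n)))"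
      by (simp add: real_symb_def X_def)
    then show ?thesis using n by (simp add: field_simps)
  qed
  define V where "V = (\<Inter>i. {s. 0 < X s i} \<inter> {s. X s i < 2 * pi}) \<inter> {s. \<bar>real_symb E j (X s)\<bar> < \<tau>}"
  have "open V" unfolding V_def X_def real_symb_def
    by (intro open_Int open_INT open_Collect_less continuous_intros finite ballI)
  moreover have "0 \<in> V" using \<theta> \<tau> r0 n by (auto simp: V_def X_def)
  ultimately obtain e where e: "e > 0" "ball 0 e \<subseteq> V" by (meson open_contains_ball)
  define \<phi> where "\<phi> = (\<lambda>s. fermi E j g p (z s))"
  have hz: "(\<lambda>s. z s i) holomorphic_on A" for i A
    unfolding z_def by (intro holomorphic_intros)
  have hs: "(\<lambda>s. symb E j (z s)) holomorphic_on A" for A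
    unfolding symb_def by (intro holomorphic_intros hz)
  have "bounded ((\<lambda>s. symb E j (z s)) ` cball 0 2)"
    by (intro compact_imp_bounded compact_continuous_image holomorphic_on_imp_continuous_on hs) simp
  then obtain b where b: "\<And>s. s \<in> cball 0 2 \<Longrightarrow> cmod (symb E j (z s)) \<le> b"
    unfolding bounded_iff by blast
  define M where "M = 2 * (\<Sum>i\<in>UNIV. \<bar>y i - \<theta>\<bar>)"
  have M: "\<bar>Im (z s i)\<bar> \<le> M" if "s \<in> cball 0 2" for s i
  proof -
    have "\<bar>Im (z s i)\<bar> = \<bar>Im s\<bar> * \<bar>y i - \<theta>\<bar>" by (simp add: z_def abs_mult)
    also have "\<dots> \<le> 2 * (\<Sum>i\<in>UNIV. \<bar>y i - \<theta>\<bar>)"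
      using that abs_Im_le_cmod[of s] by (intro mult_mono member_le_sum) auto
    finally show ?thesis by (simp add: M_def)
  qed
  \<comment> \<open>Uniform convergence on the closed disc of radius 2 makes \<open>\<phi>\<close>
    holomorphic on an open disc that contains both \<open>s = 0\<close> and
    \<open>s = 1\<close>.\<close>
  have ul: "uniform_limit (cball 0 2) (\<lambda>S s. \<Sum>\<xi>\<in>S. g \<xi> * (torus_char j \<xi> (z s) * cheb_int (symb E j (z s)) (\<xi> $ j - p)))
      \<phi> (finite_subsets_at_top UNIV)"
    unfolding \<phi>_def fermi_def
    by (rule Weierstrass_m_test_general[OF fermi_term_le[OF M b]])
       (assumption | intro summable_on_cmult_right superexp_summable g)+
  have hterm: "(\<lambda>s. \<Sum>\<xi>\<in>S. g \<xi> * (torus_char j \<xi> (z s) * cheb_int (symb E j (z s)) (\<xi> $ j - p))) holomorphic_on A" for S A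
    unfolding torus_char_def by (intro holomorphic_intros holomorphic_on_cheb_int hs hz)
  obtain "\<phi> holomorphic_on ball 0 2"
    by (rule holomorphic_uniform_limit[OF _ ul])
       (use hterm holomorphic_on_imp_continuous_on[OF hterm] in auto)
  then have "\<phi> 1 = 0"
  \<comment> \<open>The zeros for small positive real \<open>s\<close> accumulate at 0.\<close>
  proof (rule analytic_continuation[where U = "of_real ` {0<..<min e 1}" and \<xi> = 0])
    show "of_real ` {0<..<min e 1} \<subseteq> ball (0::complex) 2" by auto
    show "(0::complex) islimpt of_real ` {0<..<min e 1}"
      unfolding islimpt_approachable
    proof (intro allI impI)
      fix d :: real assume "d > 0"
      define s where "s = min (min e 1) d / 2"
      have s: "s \<in> {0<..<min e 1}" "s < d" using \<open>d > 0\<close> e(1) by (auto simp: s_def)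
      then show "\<exists>x'\<in>of_real ` {0<..<min e 1}. x' \<noteq> (0::complex) \<and> dist x' 0 < d"
        by (intro bexI[OF _ imageI[OF s(1)]]) auto
    qed
    fix w :: complex assume "w \<in> of_real ` {0<..<min e 1}"
    then obtain s where s: "w = of_real s" "0 < s" "s < e" by auto
    then have "s \<in> V" using e(2) by auto
    then have "fermi E j g p (\<lambda>i. of_real (X s i)) = 0"
      by (intro fermi_eq_0_elliptic[OF u g _ _ _ \<tau>(2)]) (auto simp: V_def)
    then show "\<phi> w = 0" by (simp add: \<phi>_def s z_def X_def)
  qed auto
  then show ?thesis by (simp add: \<phi>_def z_def)
qed

section \<open>From Chebyshev families to powers of the roots\<close>

lemma recurrence_unique:
  fixes a b :: "int \<Rightarrow> complex"
  assumes "\<And>m. a (m + 1) + a (m - 1) = t * a m" "\<And>m. b (m + 1) + b (m - 1) = t * b m"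
    and "a 0 = b 0" "a 1 = b 1"
  shows "a m = b m"
proof -
  have "a m = b m \<and> a (m + 1) = b (m + 1)"
  proof (induction m rule: int_induct[of _ 0])
    case (step1 m)
    have "a (m + 1 + 1) = t * a (m + 1) - a m" "b (m + 1 + 1) = t * b (m + 1) - b m"
      using assms(1,2)[of "m + 1"] by (simp_all add: eq_diff_eq)
    then show ?case using step1 by simp
  next
    case (step2 m)
    then show ?case using assms(1,2)[of m] by (metis add_left_cancel diff_add_cancel)
  qed (use assms in auto)
  then show ?thesis ..
qed

text \<open>Both sides solve the same recurrence and agree at \<open>m = 0\<close> and
  \<open>m = 1\<close>. There is no division by \<open>r - inverse r\<close>, so the double roots 1
  and -1 are included.\<close>

lemma power_int_eq_cheb_int:
  assumes "r \<noteq> 0" "r + inverse r = t"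
  shows "r powi m = r * cheb_int t m - cheb_int t (m - 1)"
proof (rule recurrence_unique[where t = t and a = "\<lambda>m. r powi m" and b = "\<lambda>m. r * cheb_int t m - cheb_int t (m - 1)"])
  fix m
  have "r powi (m + 1) + r powi (m - 1) = (r + inverse r) * r powi m"
    using assms(1) by (simp add: power_int_add power_int_diff divide_inverse algebra_simps)
  then show "r powi (m + 1) + r powi (m - 1) = t * r powi m" by (simp only: assms(2))
  show "r * cheb_int t (m + 1) - cheb_int t (m + 1 - 1) + (r * cheb_int t (m - 1) - cheb_int t (m - 1 - 1)) =
      t * (r * cheb_int t m - cheb_int t (m - 1))"
    using cheb_int_recurrence[of t m] cheb_int_recurrence[of t "m - 1"] by (simp add: algebra_simps) algebra
qed (simp_all add: cheb_int_def)

text \<open>A combination of the vanishing functions \<open>fermi\<close> for \<open>p = 0\<close>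
  and \<open>p = 1\<close>. It covers the growing root as well as the small one, at every real
  \<open>x\<close>.\<close>

lemma power_sum_eq_0:
  fixes u g :: "int ^ 'n::finite \<Rightarrow> complex"
  assumes u: "small_average u"
    and g: "superexp g" "\<And>\<xi>. nbsum u \<xi> - of_real E * u \<xi> = g \<xi>"
    and E: "\<bar>E\<bar> < 2 * real CARD('n)"
    and r: "r \<noteq> 0" "r + inverse r = of_real (real_symb E j x)"
  shows "((\<lambda>\<xi>. g \<xi> * (real_char j \<xi> x * r powi (\<xi> $ j))) has_sum 0) UNIV"
proof -
  have hs: "((\<lambda>\<xi>. g \<xi> * (real_char j \<xi> x * cheb_int (of_real (real_symb E j x)) (\<xi> $ j - p))) has_sum 0) UNIV" for p
  proof -
    have "(\<lambda>\<xi>. g \<xi> * (real_char j \<xi> x * cheb_int (of_real (real_symb E j x)) (\<xi> $ j - p))) summable_on UNIV"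
      by (rule abs_summable_summable, rule summable_on_comparison_test[OF _ norm_fermi_real_term_le])
         (auto intro!: summable_on_cmult_right superexp_summable g)
    then show ?thesis
      using fermi_eq_0[OF u g E, of j p x] has_sum_infsum by (fastforce simp: fermi_def symb_of_real)
  qed
  have "((\<lambda>\<xi>. r * (g \<xi> * (real_char j \<xi> x * cheb_int (of_real (real_symb E j x)) (\<xi> $ j - 0)))
      + (-1) * (g \<xi> * (real_char j \<xi> x * cheb_int (of_real (real_symb E j x)) (\<xi> $ j - 1)))) has_sum r * 0 + (-1) * 0) UNIV"
    by (intro has_sum_add has_sum_cmult_right hs)
  then show ?thesis
    by (simp add: power_int_eq_cheb_int[OF r] algebra_simps)
qed

section \<open>Decay of solutions\<close>

text \<open>The root of smaller modulus of \<open>r + 1 / r = t\<close>; on \<open>\<bar>t\<bar> \<le> 2\<close> both roots are unimodular.\<close>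

definition small_root :: "real \<Rightarrow> complex" where
  "small_root t = (if \<bar>t\<bar> \<le> 2 then of_real (t / 2) + \<i> * of_real (sqrt (1 - (t / 2)\<^sup>2))
     else of_real ((t - sgn t * sqrt (t\<^sup>2 - 4)) / 2))"

lemma measurable_small_root [measurable]: "small_root \<in> borel_measurable borel"
  unfolding small_root_def[abs_def] sgn_real_def by measurable

text \<open>The two roots have product 1. For \<open>\<bar>t\<bar> \<le> 2\<close> they are complex
  conjugates; otherwise they are real, and the factor \<open>sgn t\<close> makes the square root
  reduce the modulus.\<close>

lemma small_root:
  shows "small_root t \<noteq> 0" "small_root t + inverse (small_root t) = of_real t" "cmod (small_root t) \<le> 1"
proof -
  have "small_root t \<noteq> 0 \<and> small_root t + inverse (small_root t) = of_real t \<and> cmod (small_root t) \<le> 1"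
  proof (cases "\<bar>t\<bar> \<le> 2")
    case True
    define v where "v = sqrt (1 - (t / 2)\<^sup>2)"
    have "(t / 2)\<^sup>2 \<le> 1" using True by (simp add: abs_square_le_1)
    then have v: "v\<^sup>2 = 1 - (t / 2)\<^sup>2" by (simp add: v_def)
    have r: "small_root t = Complex (t / 2) v"
      using True by (simp add: small_root_def v_def complex_eq_iff)
    have n: "cmod (small_root t) = 1" unfolding r by (simp add: cmod_def v)
    then have "small_root t * cnj (small_root t) = 1"
      using complex_norm_square[of "small_root t"] by simp
    then have "inverse (small_root t) = cnj (small_root t)" by (rule inverse_unique)
    moreover have "small_root t + cnj (small_root t) = of_real t" by (simp add: r complex_eq_iff)
    ultimately show ?thesis using n by auto
  next
    case False
    define s where "s = sqrt (t\<^sup>2 - 4)"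
    have "2\<^sup>2 \<le> \<bar>t\<bar>\<^sup>2" using False by (intro power_mono) auto
    then have s2: "s\<^sup>2 = t\<^sup>2 - 4" by (simp add: s_def)
    define a where "a = (t - sgn t * s) / 2"
    define b where "b = (t + sgn t * s) / 2"
    have sg: "sgn t * sgn t = 1" using False by (auto simp: sgn_real_def)
    have "a * b = (t * t - (sgn t * sgn t) * s\<^sup>2) / 4"
      by (simp add: a_def b_def power2_eq_square algebra_simps)
    then have ab: "a * b = 1" unfolding sg s2 by (simp add: power2_eq_square)
    then have a0: "a \<noteq> 0" and "inverse a = b" by (auto intro: inverse_unique)
    then have sum: "a + inverse a = t" by (simp add: a_def b_def field_simps)
    \<comment> \<open>This amounts to \<open>\<bar>a\<bar> \<le> 1\<close>, since
      \<open>2 * \<bar>a\<bar> = \<bar>t\<bar> - s\<close>.\<close>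
    have "\<bar>t\<bar> - 2 \<le> s"
    proof -
      have "(\<bar>t\<bar> - 2)\<^sup>2 \<le> t\<^sup>2 - 4" using False by (simp add: power2_diff)
      then show ?thesis unfolding s_def by (rule real_le_rsqrt)
    qed
    moreover have "s \<le> \<bar>t\<bar>" unfolding s_def by (rule real_le_lsqrt) auto
    ultimately have "\<bar>a\<bar> \<le> 1" using False unfolding a_def by (auto simp: sgn_real_def)
    moreover have r: "small_root t = of_real a" using False by (simp add: small_root_def a_def s_def)
    moreover have "of_real a + inverse (of_real a) = (of_real t :: complex)"
      using sum by (metis of_real_add of_real_inverse)
    ultimately show ?thesis using a0 by simp
  qed
  then show "small_root t \<noteq> 0" "small_root t + inverse (small_root t) = of_real t" "cmod (small_root t) \<le> 1"
    by auto
qed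

lemma norm_inverse_small_root_le: "cmod (inverse (small_root t)) \<le> 1 + \<bar>t\<bar>"
proof -
  have "inverse (small_root t) = of_real t - small_root t" using small_root(2)[of t] by (metis add_diff_cancel_left')
  then show ?thesis using norm_triangle_ineq4[of "of_real t" "small_root t"] small_root(3)[of t] by simp
qed

text \<open>The kernel \<open>sgn(k) r^|k|\<close> stays bounded as \<open>r\<close> approaches 1 or
  -1, where the fundamental solution with denominator \<open>r - inverse r\<close> blows up. The
  price is a source at two points, hence an estimate for a difference of values of
  \<open>u\<close>.\<close>

lemma axis_difference_decay:
  fixes u g :: "int ^ 'n::finite \<Rightarrow> complex"
  assumes u: "small_average u"
    and g: "superexp g" "\<And>\<xi>. nbsum u \<xi> - of_real E * u \<xi> = g \<xi>"
    and E: "\<bar>E\<bar> < 2 * real CARD('n)" and a: "0 \<le> a"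
  shows "\<exists>D. \<forall>\<eta>. cmod (u (\<eta> + axis j 1) - u (\<eta> - axis j 1)) \<le> D * exp (- a * \<bar>real_of_int (\<eta> $ j)\<bar>)"
proof -
  \<comment> \<open>Bounds both roots: the small one has modulus at most 1, and its inverse is
    \<open>t\<close> minus the small one.\<close>
  define K where "K = 1 + (\<bar>E\<bar> + 2 * real CARD('n))"
  have K1: "1 \<le> K" by (simp add: K_def)
  define rt where "rt = (\<lambda>x. small_root (real_symb E j x))"
  have rt: "rt x \<noteq> 0" "rt x + inverse (rt x) = of_real (real_symb E j x)" "cmod (rt x) \<le> 1" "cmod (inverse (rt x)) \<le> K" for x
    using small_root[of "real_symb E j x"] norm_inverse_small_root_le[of "real_symb E j x"] abs_real_symb_le[of E j x]
    unfolding rt_def K_def by auto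
  define s where "s = (\<lambda>k x. of_int (sgn k) * rt x ^ nat \<bar>k\<bar>)"
  have ms [measurable]: "s k \<in> borel_measurable torus" for k unfolding s_def rt_def by measurable
  have bs: "cmod (s k x) \<le> 1" for k x
    by (cases "k = 0") (auto simp: s_def norm_mult norm_power rt power_le_one sgn_if)
  \<comment> \<open>At \<open>k = 0\<close> the neighbours cancel by oddness; at
    \<open>k = 1\<close> the value \<open>s 0 = 0\<close> replaces the power \<open>r^0 = 1\<close>,
    which leaves the defect -1, and symmetrically at \<open>k = - 1\<close>.\<close>
  have rec_s: "s (k + 1) x + s (k - 1) x - of_real (real_symb E j x) * s k x = (if k = 1 then - 1 else if k = - 1 then 1 else 0)" for k x
  proof -
    have inv: "rt x * inverse (rt x) = 1" using rt(1) by simp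
    consider "k = 0" | "k = 1" | "k = -1" | n where "k = int (Suc (Suc n))" | n where "k = - int (Suc (Suc n))"
      by (cases k rule: int_cases3) (metis One_nat_def gr0_implies_Suc not0_implies_Suc of_nat_1)+
    then show ?thesis
    proof cases
      case (4 n)
      then have "nat \<bar>k + 1\<bar> = Suc (Suc (Suc n))" "nat \<bar>k - 1\<bar> = Suc n" "nat \<bar>k\<bar> = Suc (Suc n)"
        "sgn (k + 1) = 1" "sgn (k - 1) = 1" "sgn k = 1" "k \<noteq> 1" "k \<noteq> -1" by auto
      then show ?thesis using rt(1)[of x] by (simp add: s_def rt(2)[symmetric] field_simps)
    next
      case (5 n)
      then have "nat \<bar>k - 1\<bar> = Suc (Suc (Suc n))" "nat \<bar>k + 1\<bar> = Suc n" "nat \<bar>k\<bar> = Suc (Suc n)"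
        "sgn (k + 1) = -1" "sgn (k - 1) = -1" "sgn k = -1" "k \<noteq> 1" "k \<noteq> -1" by auto
      then show ?thesis using rt(1)[of x] by (simp add: s_def rt(2)[symmetric] field_simps)
    qed (use inv in \<open>simp_all add: s_def rt(2)[symmetric] power2_eq_square algebra_simps\<close>)
  qed
  define D where "D = (\<Sum>\<^sub>\<infinity>\<xi>. 2 * (cmod (g \<xi>) * exp ((ln K + a) * l1norm \<xi>)))"
  have "cmod (u (\<eta> + axis j 1) - u (\<eta> - axis j 1)) \<le> D * exp (- a * \<bar>real_of_int (\<eta> $ j)\<bar>)" for \<eta>
  proof -
    define m0 where "m0 = \<eta> $ j"
    \<comment> \<open>The character of \<open>- \<eta>\<close> and the shift by \<open>m0\<close>
      centre the kernel at \<open>\<eta>\<close>.\<close>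
    define q where "q = (\<lambda>m x. real_char j (- \<eta>) x * s (m - m0) x)"
    define Q where "Q = (\<lambda>m x. real_char j (- \<eta>) x * (if m = m0 + 1 then - 1 else if m = m0 - 1 then 1 else 0))"
    have Q: "Q m x = q (m + 1) x + q (m - 1) x - of_real (real_symb E j x) * q m x" for m x
    proof -
      have "q (m + 1) x + q (m - 1) x - of_real (real_symb E j x) * q m x = real_char j (- \<eta>) x *
          (s (m - m0 + 1) x + s (m - m0 - 1) x - of_real (real_symb E j x) * s (m - m0) x)"
        by (simp add: q_def algebra_simps)
      also have "\<dots> = Q m x" unfolding rec_s Q_def by auto
      finally show ?thesis ..
    qed
    have intQ: "(\<integral>x. real_char j \<xi> x * Q (\<xi> $ j) x \<partial>torus) =
        (if \<xi> = \<eta> + axis j 1 then - 1 else if \<xi> = \<eta> - axis j 1 then 1 else 0)" for \<xi>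
    proof -
      define c :: complex where "c = (if \<xi> $ j = m0 + 1 then - 1 else if \<xi> $ j = m0 - 1 then 1 else 0)"
      have "(\<integral>x. real_char j \<xi> x * Q (\<xi> $ j) x \<partial>torus) = (\<integral>x. real_char j (\<xi> - \<eta>) x * c \<partial>torus)"
        by (intro Bochner_Integration.integral_cong refl)
           (simp add: Q_def c_def torus_char_add[of _ _ "- _", simplified])
      also have "\<dots> = (if \<forall>i. i \<noteq> j \<longrightarrow> (\<xi> - \<eta>) $ i = 0 then 1 else 0) * c"
        unfolding integral_real_char[symmetric] by simp
      also have "\<dots> = (if \<xi> = \<eta> + axis j 1 then - 1 else if \<xi> = \<eta> - axis j 1 then 1 else 0)"
      proof -
        have "\<xi> = \<eta> + axis j 1 \<longleftrightarrow> (\<forall>i. i \<noteq> j \<longrightarrow> (\<xi> - \<eta>) $ i = 0) \<and> \<xi> $ j = m0 + 1"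
          "\<xi> = \<eta> - axis j 1 \<longleftrightarrow> (\<forall>i. i \<noteq> j \<longrightarrow> (\<xi> - \<eta>) $ i = 0) \<and> \<xi> $ j = m0 - 1"
          by (auto simp: vec_eq_iff axis_def m0_def)
        then show ?thesis by (auto simp: c_def)
      qed
      finally show ?thesis .
    qed
    have ne: "\<eta> + axis j 1 \<noteq> \<eta> - axis j 1"
    proof
      assume "\<eta> + axis j 1 = \<eta> - axis j 1"
      then have "(\<eta> + axis j 1) $ j = (\<eta> - axis j 1) $ j" by (rule arg_cong)
      then show False by simp
    qed
    have "(\<integral>x. (\<Sum>\<^sub>\<infinity>\<xi>. g \<xi> * (real_char j \<xi> x * q (\<xi> $ j) x)) \<partial>torus) =
        (\<Sum>\<xi>\<in>{\<eta> + axis j 1, \<eta> - axis j 1}. u \<xi> * (\<integral>x. real_char j \<xi> x * Q (\<xi> $ j) x \<partial>torus))"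
    proof (rule kernel_pairing[where C = 1 and E = E and q = q and Q = Q and w = "\<lambda>\<xi>. \<integral>x. real_char j \<xi> x * q (\<xi> $ j) x \<partial>torus"])
      show "q m \<in> borel_measurable torus" for m unfolding q_def by measurable
      show "cmod (q m x) \<le> 1" for m x by (simp add: q_def norm_mult bs)
    qed (rule refl Q u g | simp add: intQ)+
    also have "\<dots> = u (\<eta> - axis j 1) - u (\<eta> + axis j 1)"
      using ne by (simp add: intQ)
    finally have "cmod (u (\<eta> + axis j 1) - u (\<eta> - axis j 1)) =
        cmod (\<integral>x. (\<Sum>\<^sub>\<infinity>\<xi>. g \<xi> * (real_char j \<xi> x * q (\<xi> $ j) x)) \<partial>torus)"
      by (simp add: norm_minus_commute)
    also have "\<dots> \<le> D * exp (- a * \<bar>real_of_int m0\<bar>)"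
    proof (rule norm_integral_torus_le)
      fix x
      \<comment> \<open>Adding the vanishing sum over \<open>c r\<^sup>m\<close> cancels every term with \<open>m\<close> on the origin's side of \<open>m0\<close>.\<close>
      define \<sigma> :: int where "\<sigma> = (if 0 \<le> m0 then 1 else - 1)"
      define r where "r = (if 0 \<le> m0 then inverse (rt x) else rt x)"
      have \<sigma>m: "\<sigma> * m0 = \<bar>m0\<bar>" and \<sigma>2: "\<sigma> = 1 \<or> \<sigma> = -1" by (auto simp: \<sigma>_def)
      have r: "r \<noteq> 0" "r + inverse r = of_real (real_symb E j x)" "cmod r \<le> K" "cmod (inverse r) \<le> K"
        using rt[of x] K1 by (auto simp: r_def add.commute)
      define c where "c = of_int \<sigma> * r powi (- m0)"
      define b where "b = (\<lambda>m. s (m - m0) x + c * r powi m)"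
      have hz: "((\<lambda>\<xi>. g \<xi> * (real_char j \<xi> x * r powi (\<xi> $ j))) has_sum 0) UNIV"
        by (rule power_sum_eq_0[OF u g E r(1,2)])
      have sq: "(\<lambda>\<xi>. g \<xi> * (real_char j \<xi> x * s (\<xi> $ j - m0) x)) summable_on UNIV"
      proof (rule abs_summable_summable, rule summable_on_comparison_test)
        show "(\<lambda>\<xi>. cmod (g \<xi>) * exp (0 * l1norm \<xi>)) summable_on UNIV" by (rule superexp_summable[OF g(1)])
        show "cmod (g \<xi> * (real_char j \<xi> x * s (\<xi> $ j - m0) x)) \<le> cmod (g \<xi>) * exp (0 * l1norm \<xi>)" for \<xi>
          using mult_left_mono[OF bs[of "\<xi> $ j - m0" x], of "cmod (g \<xi>)"] by (simp add: norm_mult)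
      qed simp
      have "((\<lambda>\<xi>. g \<xi> * (real_char j \<xi> x * s (\<xi> $ j - m0) x) + c * (g \<xi> * (real_char j \<xi> x * r powi (\<xi> $ j))))
          has_sum (\<Sum>\<^sub>\<infinity>\<xi>. g \<xi> * (real_char j \<xi> x * s (\<xi> $ j - m0) x)) + c * 0) UNIV"
        by (intro has_sum_add has_sum_infsum sq has_sum_cmult_right hz)
      then have hb: "((\<lambda>\<xi>. g \<xi> * (real_char j \<xi> x * b (\<xi> $ j))) has_sum
          (\<Sum>\<^sub>\<infinity>\<xi>. g \<xi> * (real_char j \<xi> x * s (\<xi> $ j - m0) x))) UNIV"
        by (simp add: b_def algebra_simps)
      have c_powi: "c * r powi m = of_int \<sigma> * r powi (m - m0)" for m
        using power_int_add[of r "- m0" m] r(1) by (simp add: c_def)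
      \<comment> \<open>Where \<open>b m\<close> is not cancelled,
        \<open>\<bar>m\<bar> \<ge> \<bar>m0\<bar>\<close>, so the last exponential is at least 1 and
        may be inserted. It supplies the decay in \<open>m0\<close>, while its growth in
        \<open>m\<close> is absorbed by \<open>g\<close>.\<close>
      have b_le: "cmod (b m) \<le> 2 * (exp (ln K * \<bar>real_of_int m\<bar>) * exp (a * (\<bar>real_of_int m\<bar> - \<bar>real_of_int m0\<bar>)))" for m
      proof (cases "\<sigma> * (m - m0) < 0")
        case True
        have "c * r powi m = of_int \<sigma> * r powi (m - m0)" by (rule c_powi)
        \<comment> \<open>For \<open>m < m0\<close> the power \<open>rt^(m0 - m)\<close> is the
          power \<open>m - m0\<close> of the inverse root, and for \<open>m > m0\<close> it is
          \<open>rt\<close> itself that fits; this dictates \<open>r\<close>.\<close>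
        also have "\<dots> = - s (m - m0) x"
        proof (cases "0 \<le> m0")
          case True
          with \<open>\<sigma> * (m - m0) < 0\<close> have "m - m0 < 0" by (simp add: \<sigma>_def)
          then have "sgn (m - m0) = -1" "inverse (rt x) powi (m - m0) = rt x ^ nat \<bar>m - m0\<bar>"
            by (simp_all add: power_int_def)
          then show ?thesis using True \<open>sgn (m - m0) = -1\<close> by (simp add: s_def \<sigma>_def r_def)
        next
          case False
          with \<open>\<sigma> * (m - m0) < 0\<close> have "m - m0 > 0" by (simp add: \<sigma>_def)
          then have "sgn (m - m0) = 1" "rt x powi (m - m0) = rt x ^ nat \<bar>m - m0\<bar>"
            by (simp_all add: power_int_def)
          then show ?thesis using False \<open>sgn (m - m0) = 1\<close> by (simp add: s_def \<sigma>_def r_def)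
        qed
        finally have "b m = 0" by (simp add: b_def)
        then show ?thesis by simp
      next
        case False
        then have le: "\<bar>m0\<bar> \<le> \<bar>m\<bar>" "\<bar>m - m0\<bar> \<le> \<bar>m\<bar>"
          by (auto simp: \<sigma>_def split: if_splits)
        have "cmod (c * r powi m) = cmod (r powi (m - m0))"
          unfolding c_powi using \<sigma>2 by (auto simp: norm_mult)
        also have "\<dots> \<le> K ^ nat \<bar>m - m0\<bar>"
        proof (cases "0 \<le> m - m0")
          case True
          then show ?thesis using r(3) by (simp add: power_int_def norm_power power_mono)
        next
          case False
          then show ?thesis using r(4) by (simp add: power_int_def norm_power power_mono norm_inverse)
        qed
        also have "\<dots> \<le> K ^ nat \<bar>m\<bar>" using K1 le by (intro power_increasing) auto
        finally have "cmod (b m) \<le> 1 + K ^ nat \<bar>m\<bar>"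
          unfolding b_def by (intro norm_triangle_le add_mono bs)
        also have "\<dots> \<le> 2 * K ^ nat \<bar>m\<bar>" using K1 by simp
        also have "K ^ nat \<bar>m\<bar> = exp (ln K * \<bar>real_of_int m\<bar>)"
        proof -
          have "exp (real (nat \<bar>m\<bar>) * ln K) = K ^ nat \<bar>m\<bar>" by (subst exp_of_nat_mult) (use K1 in simp)
          then show ?thesis by (simp add: mult.commute)
        qed
        also have "2 * exp (ln K * \<bar>real_of_int m\<bar>) \<le>
            2 * (exp (ln K * \<bar>real_of_int m\<bar>) * exp (a * (\<bar>real_of_int m\<bar> - \<bar>real_of_int m0\<bar>)))"
          using le a by (simp add: mult_le_cancel_left1)
        finally show ?thesis by simp
      qed
      have "(\<Sum>\<^sub>\<infinity>\<xi>. g \<xi> * (real_char j \<xi> x * q (\<xi> $ j) x)) =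
          (\<Sum>\<^sub>\<infinity>\<xi>. real_char j (- \<eta>) x * (g \<xi> * (real_char j \<xi> x * s (\<xi> $ j - m0) x)))"
        by (simp add: q_def mult_ac)
      then have "cmod (\<Sum>\<^sub>\<infinity>\<xi>. g \<xi> * (real_char j \<xi> x * q (\<xi> $ j) x)) =
          cmod (\<Sum>\<^sub>\<infinity>\<xi>. g \<xi> * (real_char j \<xi> x * s (\<xi> $ j - m0) x))"
        by (simp only: infsum_cmult_right' norm_mult norm_real_char mult_1)
      also have "\<dots> \<le> (\<Sum>\<^sub>\<infinity>\<xi>. (2 * (cmod (g \<xi>) * exp ((ln K + a) * l1norm \<xi>))) * exp (- a * \<bar>real_of_int m0\<bar>))"
      proof (rule norm_infsum_le[OF hb])
        show "((\<lambda>\<xi>. (2 * (cmod (g \<xi>) * exp ((ln K + a) * l1norm \<xi>))) * exp (- a * \<bar>real_of_int m0\<bar>)) has_sum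
          (\<Sum>\<^sub>\<infinity>\<xi>. (2 * (cmod (g \<xi>) * exp ((ln K + a) * l1norm \<xi>))) * exp (- a * \<bar>real_of_int m0\<bar>))) UNIV"
          by (intro has_sum_infsum summable_on_cmult_left summable_on_cmult_right superexp_summable g)
        fix \<xi> :: "int ^ 'n"
        have "exp (ln K * \<bar>real_of_int (\<xi> $ j)\<bar>) * exp (a * (\<bar>real_of_int (\<xi> $ j)\<bar> - \<bar>real_of_int m0\<bar>)) =
            exp ((ln K + a) * \<bar>real_of_int (\<xi> $ j)\<bar>) * exp (- a * \<bar>real_of_int m0\<bar>)"
          by (simp add: exp_add[symmetric] algebra_simps)
        also have "\<dots> \<le> exp ((ln K + a) * l1norm \<xi>) * exp (- a * \<bar>real_of_int m0\<bar>)"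
          using a K1 component_le_l1norm[of \<xi> j] by (intro mult_right_mono) (auto intro!: mult_left_mono)
        finally have "cmod (b (\<xi> $ j)) \<le> 2 * (exp ((ln K + a) * l1norm \<xi>) * exp (- a * \<bar>real_of_int m0\<bar>))"
          using b_le[of "\<xi> $ j"] by linarith
        then have "cmod (g \<xi>) * cmod (b (\<xi> $ j)) \<le> cmod (g \<xi>) * (2 * (exp ((ln K + a) * l1norm \<xi>) * exp (- a * \<bar>real_of_int m0\<bar>)))"
          by (rule mult_left_mono) simp
        then show "cmod (g \<xi> * (real_char j \<xi> x * b (\<xi> $ j))) \<le> (2 * (cmod (g \<xi>) * exp ((ln K + a) * l1norm \<xi>))) * exp (- a * \<bar>real_of_int m0\<bar>)"
          by (simp add: norm_mult mult_ac)
      qed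
      also have "\<dots> = D * exp (- a * \<bar>real_of_int m0\<bar>)"
        unfolding D_def by (rule infsum_cmult_left')
      finally show "cmod (\<Sum>\<^sub>\<infinity>\<xi>. g \<xi> * (real_char j \<xi> x * q (\<xi> $ j) x)) \<le> D * exp (- a * \<bar>real_of_int m0\<bar>)" .
    qed
    finally show ?thesis by (simp add: m0_def)
  qed
  then show ?thesis by blast
qed

text \<open>Values of modulus at least \<open>\<epsilon>\<close> along a half-line would contribute
  a fixed multiple of \<open>R\<close> to the ball sums. Spacing 2 matches the difference estimate,
  which links \<open>\<eta> + e_j\<close> to \<open>\<eta> - e_j\<close>.\<close>

lemma not_bounded_below_along_axis:
  fixes u :: "int ^ 'n::finite \<Rightarrow> complex"
  assumes u: "small_average u" and \<sigma>: "\<bar>\<sigma>\<bar> = 1" and \<epsilon>: "\<epsilon> > 0"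
  shows "\<exists>k. cmod (u (\<xi> + axis j (\<sigma> * (2 * int k)))) < \<epsilon>"
proof (rule ccontr)
  assume "\<nexists>k. cmod (u (\<xi> + axis j (\<sigma> * (2 * int k)))) < \<epsilon>"
  then have ge: "\<epsilon> \<le> cmod (u (\<xi> + axis j (\<sigma> * (2 * int k))))" for k by (meson not_le)
  \<comment> \<open>The factor 4 suffices because a ball of radius at most \<open>3 * k0\<close>
    will contain \<open>k0 + 1\<close> points of the half-line.\<close>
  have "eventually (\<lambda>R. dist ((1 / R) * (\<Sum>\<xi>\<in>zball R. (cmod (u \<xi>))\<^sup>2)) 0 < \<epsilon>\<^sup>2 / 4) at_top"
    using u \<epsilon> unfolding small_average_def by (intro tendstoD) auto
  then obtain R0 where R0: "\<And>R. R \<ge> R0 \<Longrightarrow> dist ((1 / R) * (\<Sum>\<xi>\<in>zball R. (cmod (u \<xi>))\<^sup>2)) 0 < \<epsilon>\<^sup>2 / 4"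
    unfolding eventually_at_top_linorder by blast
  define k0 where "k0 = nat \<lceil>max (max (zn_norm \<xi>) R0) 1\<rceil>"
  have k0: "zn_norm \<xi> \<le> k0" "R0 \<le> k0" "1 \<le> k0"
    using real_nat_ceiling_ge[of "max (max (zn_norm \<xi>) R0) 1"] unfolding k0_def by linarith+
  define R where "R = zn_norm \<xi> + 2 * k0"
  have R: "R \<ge> R0" "R > 0" "R \<le> 3 * k0" using k0 zn_norm_nonneg[of \<xi>] unfolding R_def by linarith+
  define P where "P = (\<lambda>k. \<xi> + axis j (\<sigma> * (2 * int k)))"
  have inj: "inj_on P {..k0}"
  proof (rule inj_onI)
    fix k l assume "P k = P l"
    then have "P k $ j = P l $ j" by simp
    then show "k = l" using \<sigma> by (auto simp: P_def)
  qed
  have "P k \<in> zball R" if "k \<le> k0" for k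
  proof -
    have "zn_norm (axis j (\<sigma> * (2 * int k)) :: int ^ 'n) = 2 * real k"
    proof -
      have "(\<Sum>i\<in>UNIV. (real_of_int ((axis j (\<sigma> * (2 * int k)) :: int ^ 'n) $ i))\<^sup>2) =
          (\<Sum>i\<in>UNIV. if i = j then (real_of_int \<sigma> * (2 * real k))\<^sup>2 else 0)"
        by (intro sum.cong) (auto simp: axis_def)
      also have "\<dots> = (2 * real k)\<^sup>2"
      proof -
        have "\<sigma> = 1 \<or> \<sigma> = -1" using \<sigma> by auto
        then show ?thesis by (auto simp: power_mult_distrib)
      qed
      finally show ?thesis by (simp only: zn_norm_def real_sqrt_abs)
    qed
    then show ?thesis
      using zn_norm_add_le[of \<xi> "axis j (\<sigma> * (2 * int k))"] that by (simp add: P_def zball_def R_def)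
  qed
  then have "(\<Sum>\<xi>\<in>P ` {..k0}. (cmod (u \<xi>))\<^sup>2) \<le> (\<Sum>\<xi>\<in>zball R. (cmod (u \<xi>))\<^sup>2)"
    by (intro sum_mono2) auto
  moreover have "(\<Sum>\<xi>\<in>P ` {..k0}. (cmod (u \<xi>))\<^sup>2) = (\<Sum>k\<le>k0. (cmod (u (P k)))\<^sup>2)"
    by (rule sum.reindex[OF inj, unfolded comp_def])
  moreover have "(\<Sum>k\<le>k0. \<epsilon>\<^sup>2) \<le> (\<Sum>k\<le>k0. (cmod (u (P k)))\<^sup>2)"
    using ge \<epsilon> by (intro sum_mono power_mono) (auto simp: P_def)
  ultimately have "real (Suc k0) * \<epsilon>\<^sup>2 \<le> (\<Sum>\<xi>\<in>zball R. (cmod (u \<xi>))\<^sup>2)" by simp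
  moreover have "(\<Sum>\<xi>\<in>zball R. (cmod (u \<xi>))\<^sup>2) < R * (\<epsilon>\<^sup>2 / 4)"
  proof -
    have "(1 / R) * (\<Sum>\<xi>\<in>zball R. (cmod (u \<xi>))\<^sup>2) < \<epsilon>\<^sup>2 / 4"
      using R0[OF R(1)] by (simp only: dist_real_def)
    then show ?thesis using R(2) by (simp add: divide_less_eq mult.commute)
  qed
  moreover have "R * (\<epsilon>\<^sup>2 / 4) \<le> real (Suc k0) * \<epsilon>\<^sup>2"
  proof -
    have "R / 4 * \<epsilon>\<^sup>2 \<le> real (Suc k0) * \<epsilon>\<^sup>2" using R by (intro mult_right_mono) auto
    then show ?thesis by simp
  qed
  ultimately show False by linarith
qed

text \<open>Summing the differences outward changes \<open>u\<close> by at most \<open>B\<close>. If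
  \<open>\<bar>u \<xi>\<bar>\<close> exceeded \<open>B\<close>, the values along the half-line would
  stay away from 0, against the small average.\<close>

lemma axis_decay:
  fixes u g :: "int ^ 'n::finite \<Rightarrow> complex"
  assumes u: "small_average u"
    and g: "superexp g" "\<And>\<xi>. nbsum u \<xi> - of_real E * u \<xi> = g \<xi>"
    and E: "\<bar>E\<bar> < 2 * real CARD('n)" and a: "0 < a"
  shows "\<exists>C\<ge>0. \<forall>\<xi>. cmod (u \<xi>) \<le> C * exp (- a * \<bar>real_of_int (\<xi> $ j)\<bar>)"
proof -
  obtain D where D: "\<And>\<eta>. cmod (u (\<eta> + axis j 1) - u (\<eta> - axis j 1)) \<le> D * exp (- a * \<bar>real_of_int (\<eta> $ j)\<bar>)"
    using axis_difference_decay[OF u g E, of a j] a by fastforce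
  have D0: "0 \<le> D"
    using order_trans[OF norm_ge_zero D[of 0]] by simp
  \<comment> \<open>\<open>D\<close> times the sum of the geometric series with ratio
    \<open>exp (- a)\<close>.\<close>
  define C where "C = D / (1 - exp (- a))"
  have C0: "0 \<le> C" using D0 a by (simp add: C_def)
  have "cmod (u \<xi>) \<le> C * exp (- a * \<bar>real_of_int (\<xi> $ j)\<bar>)" for \<xi>
  proof (rule ccontr)
    assume contra: "\<not> ?thesis"
    define B where "B = C * exp (- a * \<bar>real_of_int (\<xi> $ j)\<bar>)"
    \<comment> \<open>Points away from the hyperplane where the \<open>j\<close>-th coordinate is 0,
      so that the increments decay along the path.\<close>
    define \<sigma> :: int where "\<sigma> = (if 0 \<le> \<xi> $ j then 1 else - 1)"
    have \<sigma>: "\<bar>\<sigma>\<bar> = 1" by (simp add: \<sigma>_def)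
    define P where "P = (\<lambda>k. \<xi> + axis j (\<sigma> * (2 * int k)))"
    have step: "cmod (u (P (Suc k)) - u (P k)) \<le> D * exp (- a * \<bar>real_of_int (\<xi> $ j)\<bar>) * exp (- a) ^ k" for k
    proof -
      \<comment> \<open>The midpoint of two consecutive points; its offset \<open>2 * k + 1\<close>
        is weakened to \<open>k\<close> below.\<close>
      define \<eta> where "\<eta> = \<xi> + axis j (\<sigma> * (2 * int k + 1))"
      have s: "axis j (x + y) = (axis j x + axis j y :: int ^ 'n)" for x y by (simp add: vec_eq_iff axis_def)
      have P1: "P (Suc k) = \<eta> + axis j \<sigma>" "P k = \<eta> + axis j (- \<sigma>)"
        unfolding P_def \<eta>_def add.assoc s[symmetric] by (simp_all add: algebra_simps)
      have neg: "axis j (- 1) = (- axis j 1 :: int ^ 'n)" by (simp add: vec_eq_iff axis_def)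
      have "cmod (u (P (Suc k)) - u (P k)) = cmod (u (\<eta> + axis j 1) - u (\<eta> - axis j 1))"
        unfolding P1 by (cases "0 \<le> \<xi> $ j") (auto simp: \<sigma>_def neg norm_minus_commute)
      also have "\<dots> \<le> D * exp (- a * \<bar>real_of_int (\<eta> $ j)\<bar>)" by (rule D)
      also have "\<bar>real_of_int (\<eta> $ j)\<bar> = \<bar>real_of_int (\<xi> $ j)\<bar> + 2 * real k + 1"
        by (auto simp: \<eta>_def \<sigma>_def)
      also have "D * exp (- a * (\<bar>real_of_int (\<xi> $ j)\<bar> + 2 * real k + 1)) \<le>
          D * exp (- a * (\<bar>real_of_int (\<xi> $ j)\<bar> + real k))"
        using D0 a by (intro mult_left_mono) auto
      also have "\<dots> = D * exp (- a * \<bar>real_of_int (\<xi> $ j)\<bar>) * exp (- a) ^ k"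
        by (simp add: exp_of_nat_mult[symmetric] exp_add[symmetric] algebra_simps)
      finally show ?thesis .
    qed
    have geom: "(\<Sum>i<k. exp (- a) ^ i) \<le> 1 / (1 - exp (- a))" for k
    proof -
      have sm: "summable (\<lambda>i. exp (- a) ^ i)" using a by (intro summable_geometric) simp
      then have "(\<Sum>i<k. exp (- a) ^ i) \<le> (\<Sum>i. exp (- a) ^ i)"
        by (intro sum_le_suminf) auto
      also have "\<dots> = 1 / (1 - exp (- a))" using a by (intro suminf_geometric) simp
      finally show ?thesis .
    qed
    have "cmod (u \<xi>) - B \<le> cmod (u (P k))" for k
    proof -
      have "u (P k) - u (P 0) = (\<Sum>i<k. u (P (Suc i)) - u (P i))"
        by (rule sum_lessThan_telescope[symmetric])
      then have "cmod (u (P k) - u (P 0)) \<le> (\<Sum>i<k. D * exp (- a * \<bar>real_of_int (\<xi> $ j)\<bar>) * exp (- a) ^ i)"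
        by (metis (no_types, lifting) step sum_norm_le)
      also have "\<dots> = D * exp (- a * \<bar>real_of_int (\<xi> $ j)\<bar>) * (\<Sum>i<k. exp (- a) ^ i)"
        by (simp add: sum_distrib_left)
      also have "\<dots> \<le> D * exp (- a * \<bar>real_of_int (\<xi> $ j)\<bar>) * (1 / (1 - exp (- a)))"
        using D0 by (intro mult_left_mono geom) auto
      also have "\<dots> = B" by (simp add: B_def C_def)
      finally have "cmod (u (P k) - u (P 0)) \<le> B" .
      moreover have "P 0 = \<xi>" by (simp add: P_def vec_eq_iff axis_def)
      ultimately show ?thesis using norm_triangle_ineq2[of "u \<xi>" "u (P k)"] by (simp add: norm_minus_commute)
    qed
    moreover have "cmod (u \<xi>) - B > 0" using contra by (simp add: B_def)
    ultimately show False
      using not_bounded_below_along_axis[OF u \<sigma>, of "cmod (u \<xi>) - B" \<xi> j] unfolding P_def by (meson not_le)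
  qed
  then show ?thesis using C0 by blast
qed

text \<open>The coordinate of largest modulus is at least \<open>l1norm \<xi>\<close> divided by the
  dimension, so the axis estimate for it suffices; summing the constants covers whichever coordinate
  is largest.\<close>

lemma superexp_of_eigenvalue_equation:
  fixes u g :: "int ^ 'n::finite \<Rightarrow> complex"
  assumes u: "small_average u"
    and g: "superexp g" "\<And>\<xi>. nbsum u \<xi> - of_real E * u \<xi> = g \<xi>"
    and E: "\<bar>E\<bar> < 2 * real CARD('n)"
  shows "superexp u"
  unfolding superexp_def
proof
  fix a :: real
  define b where "b = real CARD('n) * max a 1"
  have b: "0 < b" by (simp add: b_def)
  have "\<forall>j::'n. \<exists>C\<ge>0. \<forall>\<xi>. cmod (u \<xi>) \<le> C * exp (- b * \<bar>real_of_int (\<xi> $ j)\<bar>)"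
    using axis_decay[OF u g E b] by blast
  then obtain C where C: "\<And>j. 0 \<le> C j"
    "\<And>j \<xi>. cmod (u \<xi>) \<le> C j * exp (- b * \<bar>real_of_int (\<xi> $ j)\<bar>)"
    by metis
  have "cmod (u \<xi>) \<le> (\<Sum>j\<in>UNIV. C j) * exp (- a * l1norm \<xi>)" for \<xi>
  proof -
    define h where "h = (\<lambda>i. \<bar>real_of_int (\<xi> $ i)\<bar>)"
    have "Max (range h) \<in> range h" by (rule Max_in) auto
    then obtain j where "Max (range h) = h j" by blast
    moreover have "h i \<le> Max (range h)" for i by (rule Max_ge) auto
    ultimately have j: "\<bar>real_of_int (\<xi> $ i)\<bar> \<le> \<bar>real_of_int (\<xi> $ j)\<bar>" for i
      by (simp add: h_def)
    have "l1norm \<xi> \<le> real CARD('n) * \<bar>real_of_int (\<xi> $ j)\<bar>"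
      unfolding l1norm_def using sum_bounded_above[of UNIV "\<lambda>i. \<bar>real_of_int (\<xi> $ i)\<bar>"] j by simp
    then have "max a 1 * l1norm \<xi> \<le> b * \<bar>real_of_int (\<xi> $ j)\<bar>"
      unfolding b_def by (subst mult.commute[of "real _"], subst mult.assoc) (intro mult_left_mono, auto)
    moreover have "a * l1norm \<xi> \<le> max a 1 * l1norm \<xi>" by (intro mult_right_mono) auto
    ultimately have e: "exp (- b * \<bar>real_of_int (\<xi> $ j)\<bar>) \<le> exp (- a * l1norm \<xi>)" by simp
    have "cmod (u \<xi>) \<le> C j * exp (- b * \<bar>real_of_int (\<xi> $ j)\<bar>)" by (rule C(2))
    also have "\<dots> \<le> (\<Sum>j\<in>UNIV. C j) * exp (- a * l1norm \<xi>)"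
      using C(1) e by (intro mult_mono member_le_sum sum_nonneg) auto
    finally show ?thesis .
  qed
  then show "\<exists>C. \<forall>\<xi>. cmod (u \<xi>) \<le> C * exp (- a * l1norm \<xi>)" by blast
qed

section \<open>Reduction of the theorem to the neighbour sum\<close>

lemma superexp_cmult:
  assumes "superexp f"
  shows "superexp (\<lambda>\<xi>. c * f \<xi>)"
  unfolding superexp_def
proof
  fix a
  obtain C where C: "\<And>\<xi>. cmod (f \<xi>) \<le> C * exp (- a * l1norm \<xi>)"
    using assms unfolding superexp_def by blast
  have "cmod (c * f \<xi>) \<le> (cmod c * C) * exp (- a * l1norm \<xi>)" for \<xi>
    using mult_left_mono[OF C[of \<xi>], of "cmod c"] by (simp add: norm_mult mult.assoc)
  then show "\<exists>C. \<forall>\<xi>. cmod (c * f \<xi>) \<le> C * exp (- a * l1norm \<xi>)" by blast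
qed

theorem theorem22:
  fixes f u :: "int ^ 'n \<Rightarrow> complex" and lam :: real
  assumes n2: "CARD('n) \<ge> 2"
    and f_l2: "in_l2 f"
    and f_exp: "\<And>\<gamma>::real. \<gamma> > 0 \<Longrightarrow> in_l2 (\<lambda>\<xi>. exp (\<gamma> * japanese \<xi>) * f \<xi>)"
    and u_decay: "((\<lambda>R::real. (1 / R) * (\<Sum>\<xi>\<in>{\<xi>. zn_norm \<xi> \<le> R}. (cmod (u \<xi>))\<^sup>2))
                    \<longlongrightarrow> 0) at_top"
    and lam: "0 < lam" "lam < real CARD('n)"
    and eq: "\<And>\<xi>. neg_disc_lap u \<xi> - of_real lam * u \<xi> = f \<xi>"
  shows "\<forall>\<gamma>::real. \<gamma> > 0 \<longrightarrow> in_l2 (\<lambda>\<xi>. exp (\<gamma> * japanese \<xi>) * u \<xi>)"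
proof -
  \<comment> \<open>Multiplication by -4 turns the equation into
    \<open>nbsum u - E * u = - 4 * f\<close>, and the bounds on \<open>lam\<close> become
    \<open>\<bar>E\<bar> < 2 * CARD('n)\<close>.\<close>
  define E where "E = 2 * real CARD('n) - 4 * lam"
  have "superexp u"
  proof (rule superexp_of_eigenvalue_equation)
    show "small_average u" using u_decay by (simp add: small_average_def zball_def)
    show "superexp (\<lambda>\<xi>. - 4 * f \<xi>)"
      by (intro superexp_cmult superexp_of_weighted_l2 f_exp)
    show "nbsum u \<xi> - of_real E * u \<xi> = - 4 * f \<xi>" for \<xi>
      unfolding eq[symmetric] neg_disc_lap_def nbsum_def[symmetric] E_def by (simp add: field_simps)
    show "\<bar>E\<bar> < 2 * real CARD('n)" using lam unfolding E_def by linarith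
  qed
  then show ?thesis using weighted_l2_of_superexp by blast
qed

end
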